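(* Let $A\in 2^\omega$. The following are equivalent: (i) $A\in\mathrm{Low}(\mathrm{CR},\mathrm{SR})$, i.e., $\mathrm{CR}\subseteq\mathrm{SR}^A$. (ii) Every bounded $A$-Schnorr open set can be covered by a winning open set (i.e., is contained in some winning open set).
   Context: $2^\omega$ is Cantor space, $2^{<\omega}$ the set of finite binary strings, $\epsilon$ the empty string, $\mu$ the uniform measure. For $U\subseteq 2^{<\omega}$, $[U]$ is the set of infinite sequences having a prefix in $U$. An open set is bounded if its measure is smaller than $1$. An $A$-c.e. open set is a set $[U]$ with $U$ an $A$-c.e. prefix-free set of strings; it is an $A$-Schnorr open set if its measure is an $A$-computable real. An $A$-Schnorr test is a non-increasing sequence $(\mathcal{U}_n)_{n\in\mathbb{N}}$ of uniformly $A$-c.e. open sets with $\mu(\mathcal{U}_n)=2^{-n}$ for all $n$; $\mathrm{SR}^A$ is the set of $X\in 2^\omega$ such that $X\notin\bigcap_n\mathcal{U}_n$ for every $A$-Schnorr test. A martingale is a function $d:2^{<\omega}\to\mathbb{R}^{\geq 0}$ with $d(\sigma)=\frac{d(\sigma 0)+d(\sigma 1)}{2}$ for all $\sigma$; it is normed if $d(\epsilon)=1$; it succeeds on $X$ if $\limsup_n d(X\upharpoonright n)=+\infty$. $\mathrm{CR}$ is the set of computably random sequences, i.e., those on which no computable (real-valued) martingale succeeds. A martingale is exactly computable if it is rational-valued and computable as a function into $\mathbb{Q}^{\geq 0}$. A string is minimal for a property if it satisfies the property and no proper prefix of it does. A winning open set is a set $[U]$ where $U=\{\sigma:\sigma\text{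 minimal such that }d(\sigma)\geq q\}$ for some exactly computable normed martingale $d$ and rational $q>1$. *)

theory Defs
  imports "HOL-Probability.Probability" "HOL-Library.Sublist" "HOL-Library.Nat_Bijection"
begin

section \<open>Oracle computability\<close>

text \<open>
  Partial recursive functions relative to the oracle \<open>A\<close>, as unary functions on \<^typ>\<open>nat\<close>;
  several arguments are coded with the library pairing \<^const>\<open>prod_encode\<close>.
\<close>

definition minimization :: "(nat \<Rightarrow> nat option) \<Rightarrow> nat option" where
  "minimization f =
     (if \<exists>n. f n = Some 0 \<and> (\<forall>m<n. f m \<noteq> None)
      then Some (LEAST n. f n = Some 0) else None)"

inductive partrec :: "bool stream \<Rightarrow> (nat \<Rightarrow> nat option) \<Rightarrow> bool" for A :: "bool stream" where
  zero: "partrec A (\<lambda>n. Some 0)"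
| succ: "partrec A (\<lambda>n. Some (Suc n))"
| left: "partrec A (\<lambda>n. Some (fst (prod_decode n)))"
| right: "partrec A (\<lambda>n. Some (snd (prod_decode n)))"
| query: "partrec A (\<lambda>n. Some (of_bool (A !! n)))"
| pair: "partrec A f \<Longrightarrow> partrec A g \<Longrightarrow>
    partrec A (\<lambda>n. Option.bind (f n) (\<lambda>a. Option.bind (g n) (\<lambda>b. Some (prod_encode (a, b)))))"
| comp: "partrec A f \<Longrightarrow> partrec A g \<Longrightarrow> partrec A (\<lambda>n. Option.bind (g n) f)"
| prec: "partrec A f \<Longrightarrow> partrec A g \<Longrightarrow>
    partrec A (\<lambda>n. case prod_decode n of (a, k) \<Rightarrow>
      rec_nat (f a)
        (\<lambda>y r. Option.bind r (\<lambda>i. g (prod_encode (a, prod_encode (y, i))))) k)"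
| mn: "partrec A f \<Longrightarrow> partrec A (\<lambda>n. minimization (\<lambda>k. f (prod_encode (n, k))))"

definition computable_nat :: "bool stream \<Rightarrow> (nat \<Rightarrow> nat) \<Rightarrow> bool" where
  "computable_nat A f \<longleftrightarrow> partrec A (\<lambda>n. Some (f n))"

text \<open>Computability without an oracle is computability relative to the all-zero sequence.\<close>

abbreviation no_oracle :: "bool stream" where
  "no_oracle \<equiv> sconst False"

text \<open>
  Strings and rationals are coded effectively: strings by \<^const>\<open>list_encode\<close>, rationals through
  \<^const>\<open>nat_to_rat_surj\<close>, which decodes a numerator/denominator pair. (The generic \<^const>\<open>to_nat\<close>
  of class \<^class>\<open>countable\<close> is an arbitrary injection and would not do.)
\<close>

definition string_code :: "bool list \<Rightarrow> nat" where
  "string_code \<sigma> = list_encode (map of_bool \<sigma>)"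

definition computable_real :: "bool stream \<Rightarrow> real \<Rightarrow> bool" where
  "computable_real A r \<longleftrightarrow>
     (\<exists>g. computable_nat A g \<and> (\<forall>n. \<bar>of_rat (nat_to_rat_surj (g n)) - r\<bar> \<le> (1 / 2) ^ n))"

definition computable_string_real :: "bool stream \<Rightarrow> (bool list \<Rightarrow> real) \<Rightarrow> bool" where
  "computable_string_real A d \<longleftrightarrow>
     (\<exists>g. computable_nat A g \<and>
        (\<forall>\<sigma> n. \<bar>of_rat (nat_to_rat_surj (g (prod_encode (string_code \<sigma>, n)))) - d \<sigma>\<bar> \<le> (1 / 2) ^ n))"

definition computable_string_rat :: "bool stream \<Rightarrow> (bool list \<Rightarrow> rat) \<Rightarrow> bool" where
  "computable_string_rat A f \<longleftrightarrow>
     (\<exists>g. computable_nat A g \<and> (\<forall>\<sigma>. f \<sigma> = nat_to_rat_surj (g (string_code \<sigma>))))"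

definition ce_strings :: "bool stream \<Rightarrow> bool list set \<Rightarrow> bool" where
  "ce_strings A U \<longleftrightarrow> (\<exists>\<phi>. partrec A \<phi> \<and> U = {\<sigma>. \<phi> (string_code \<sigma>) \<noteq> None})"

definition uniformly_ce_strings :: "bool stream \<Rightarrow> (nat \<Rightarrow> bool list set) \<Rightarrow> bool" where
  "uniformly_ce_strings A W \<longleftrightarrow>
     (\<exists>\<phi>. partrec A \<phi> \<and> (\<forall>n. W n = {\<sigma>. \<phi> (prod_encode (n, string_code \<sigma>)) \<noteq> None}))"

section \<open>Cantor space, open sets and tests\<close>

definition cantor_measure :: "bool stream measure" where
  "cantor_measure = stream_space (uniform_count_measure (UNIV :: bool set))"

definition prefix_free :: "bool list set \<Rightarrow> bool" where
  "prefix_free U \<longleftrightarrow> (\<forall>\<sigma>\<in>U. \<forall>\<tau>\<in>U. prefix \<sigma> \<tau> \<longrightarrow> \<sigma> = \<tau>)"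

definition open_of :: "bool list set \<Rightarrow> bool stream set" where
  "open_of U = {X. \<exists>n. stake n X \<in> U}"

definition bounded_open :: "bool stream set \<Rightarrow> bool" where
  "bounded_open S \<longleftrightarrow> (\<exists>U. S = open_of U) \<and> measure cantor_measure S < 1"

definition ce_open :: "bool stream \<Rightarrow> bool stream set \<Rightarrow> bool" where
  "ce_open A S \<longleftrightarrow> (\<exists>U. ce_strings A U \<and> prefix_free U \<and> S = open_of U)"

definition Schnorr_open :: "bool stream \<Rightarrow> bool stream set \<Rightarrow> bool" where
  "Schnorr_open A S \<longleftrightarrow> ce_open A S \<and> computable_real A (measure cantor_measure S)"

definition uniformly_ce_open :: "bool stream \<Rightarrow> (nat \<Rightarrow> bool stream set) \<Rightarrow> bool" where
  "uniformly_ce_open A T \<longleftrightarrow>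
     (\<exists>W. uniformly_ce_strings A W \<and> (\<forall>n. prefix_free (W n) \<and> T n = open_of (W n)))"

definition Schnorr_test :: "bool stream \<Rightarrow> (nat \<Rightarrow> bool stream set) \<Rightarrow> bool" where
  "Schnorr_test A T \<longleftrightarrow>
     decseq T \<and> uniformly_ce_open A T \<and> (\<forall>n. measure cantor_measure (T n) = (1 / 2) ^ n)"

definition SR :: "bool stream \<Rightarrow> bool stream set" where
  "SR A = {X. \<forall>T. Schnorr_test A T \<longrightarrow> X \<notin> (\<Inter>n. T n)}"

section \<open>Martingales\<close>

definition martingale :: "(bool list \<Rightarrow> real) \<Rightarrow> bool" where
  "martingale d \<longleftrightarrow> (\<forall>\<sigma>. d \<sigma> \<ge> 0 \<and> d \<sigma> = (d (\<sigma> @ [False]) + d (\<sigma> @ [True])) / 2)"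

definition normed :: "(bool list \<Rightarrow> real) \<Rightarrow> bool" where
  "normed d \<longleftrightarrow> d [] = 1"

definition succeeds_on :: "(bool list \<Rightarrow> real) \<Rightarrow> bool stream \<Rightarrow> bool" where
  "succeeds_on d X \<longleftrightarrow> limsup (\<lambda>n. ereal (d (stake n X))) = \<infinity>"

definition CR :: "bool stream set" where
  "CR = {X. \<forall>d. martingale d \<and> computable_string_real no_oracle d \<longrightarrow> \<not> succeeds_on d X}"

definition exactly_computable :: "(bool list \<Rightarrow> real) \<Rightarrow> bool" where
  "exactly_computable d \<longleftrightarrow>
     (\<exists>f. computable_string_rat no_oracle f \<and> (\<forall>\<sigma>. d \<sigma> = of_rat (f \<sigma>)))"

definition minimal_string :: "(bool list \<Rightarrow> bool) \<Rightarrow> bool list \<Rightarrow> bool" where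
  "minimal_string P \<sigma> \<longleftrightarrow> P \<sigma> \<and> (\<forall>\<tau>. strict_prefix \<tau> \<sigma> \<longrightarrow> \<not> P \<tau>)"

definition winning_open :: "bool stream set \<Rightarrow> bool" where
  "winning_open S \<longleftrightarrow>
     (\<exists>d (q :: rat). martingale d \<and> normed d \<and> exactly_computable d \<and> q > 1 \<and>
        S = open_of {\<sigma>. minimal_string (\<lambda>\<tau>. d \<tau> \<ge> of_rat q) \<sigma>})"

definition Low :: "bool stream set \<Rightarrow> (bool stream \<Rightarrow> bool stream set) \<Rightarrow> bool stream set" where
  "Low C D = {A. C \<subseteq> D A}"

end

theory Submission
  imports Defs
begin

text \<open>
  \<^emph>\<open>Coverings give lowness.\<close> Suppose that \<open>X\<close> is captured by an \<open>A\<close>-Schnorr test \<open>(U\<^sub>n)\<close>. Deleting the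
  first \<open>n\<close> bits of a longer string multiplies its weight by \<open>2\<^sup>n\<close>, so the sets of \<open>n\<close>-th tails of members of
  \<open>U\<^bsub>2n+2\<^esub>\<close> have total weight \<open>1/2\<close>; their union is a bounded \<open>A\<close>-Schnorr open set containing
  \<^emph>\<open>every\<close> tail of \<open>X\<close> (\<open>Schnorr_open_tails\<close>). If a martingale \<open>d\<close> reaches some \<open>q > 1\<close> on every
  member of this set, then \<open>d\<close> can be played along \<open>X\<close>, restarted with the current capital as soon
  as it has gained the factor \<open>q\<close>, and so on forever, because what remains of \<open>X\<close> is again a tail
  of \<open>X\<close>. The restarted martingale is unbounded on \<open>X\<close>, hence \<open>X\<close> is not computably random
  (\<open>winning_open_covers_tails\<close>).

  \<^emph>\<open>Lowness gives coverings.\<close> Suppose that a bounded \<open>A\<close>-Schnorr open set \<open>[U]\<close> is contained in no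
  winning open set. For an exactly computable martingale \<open>d\<close> with \<open>d \<sigma> > 0\<close>, the winning open sets
  of the rescaled martingale \<open>\<tau> \<mapsto> d (\<sigma> \<tau>) / d \<sigma>\<close> do not cover \<open>[U]\<close>; so \<open>\<sigma>\<close> has an extension
  \<open>\<sigma> u\<close> with \<open>u \<in> U\<close> along which \<open>d\<close> gains less than any prescribed factor \<open>q > 1\<close>. Iterating this,
  and adding the exactly computable martingales one after the other with small weights, produces a
  sequence \<open>0 u\<^sub>1 u\<^sub>2 \<dots>\<close> with all \<open>u\<^sub>i\<close> in \<open>U\<close> on which each of them stays bounded
  (\<open>computably_random_in_powers\<close>). Every computable martingale is dominated by an exactly computable
  one, so this sequence is computably random. Without its first bit it lies in all the sets \<open>[U\<^sup>m]\<close>,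
  whose measures are the powers of \<open>\<mu> [U] < 1\<close>, so it should fail an \<open>A\<close>-Schnorr test. The members
  of a test have measure exactly \<open>2\<^sup>-\<^sup>n\<close>; this is the reason for the leading bit \<open>0\<close>: the cone of \<open>1\<close>
  is free to receive an initial interval that fills up the measure (\<open>Schnorr_test_of_powers\<close>).

  The effectivity claims rest on a calculus of computable functions between types with a
  surjective decoding from the natural numbers, and on the fact that every partial recursive
  function is the limit of a computable stagewise approximation, so that computably enumerable
  sets are those with a decidable predicate behind one existential quantifier.
\<close>

section \<open>Computable functions between coded types\<close>

class coded =
  fixes decode :: "nat \<Rightarrow> 'a"
  assumes decode_surj: "\<exists>n. decode n = x"

instantiation nat :: coded
begin
definition decode_nat :: "nat \<Rightarrow> nat" where [simp]: "decode_nat n = n"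
instance by standard auto
end

instantiation bool :: coded
begin
definition decode_bool :: "nat \<Rightarrow> bool" where "decode_bool n \<longleftrightarrow> n \<noteq> 0"
instance proof
  fix x :: bool
  have "decode (of_bool x) = x" by (auto simp: decode_bool_def)
  then show "\<exists>n. decode n = x" ..
qed
end

instantiation prod :: (coded, coded) coded
begin
definition decode_prod :: "nat \<Rightarrow> 'a \<times> 'b" where
  "decode_prod n = (decode (fst (prod_decode n)), decode (snd (prod_decode n)))"
instance proof
  fix x :: "'a \<times> 'b"
  obtain m n where "decode m = fst x" "decode n = snd x"
    using decode_surj[of "fst x"] decode_surj[of "snd x"] by blast
  then have "decode (prod_encode (m, n)) = x" by (simp add: decode_prod_def)
  then show "\<exists>n. decode n = x" ..
qed
end

instantiation option :: (coded) coded
begin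
definition decode_option :: "nat \<Rightarrow> 'a option" where
  "decode_option n = (if n = 0 then None else Some (decode (n - 1)))"
instance proof
  fix x :: "'a option"
  show "\<exists>n. decode n = x"
  proof (cases x)
    case None
    then have "decode 0 = x" by (simp add: decode_option_def)
    then show ?thesis ..
  next
    case (Some y)
    obtain n where "decode n = y" using decode_surj[of y] by blast
    then have "decode (Suc n) = x" by (simp add: decode_option_def Some)
    then show ?thesis ..
  qed
qed
end

instantiation list :: (coded) coded
begin
definition decode_list :: "nat \<Rightarrow> 'a list" where
  "decode_list n = map decode (list_decode n)"
instance proof
  fix x :: "'a list"
  have "\<exists>l. map decode l = x"
  proof (induction x)
    case (Cons a x)
    then obtain l where l: "map decode l = x" by blast
    obtain n where "decode n = a" using decode_surj[of a] by blast
    with l have "map decode (n # l) = a # x" by simp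
    then show ?case by (rule exI)
  qed simp
  then obtain l where "map decode l = x" ..
  then have "decode (list_encode l) = x" by (simp add: decode_list_def)
  then show "\<exists>n. decode n = x" ..
qed
end

instantiation int :: coded
begin
definition decode_int :: "nat \<Rightarrow> int" where "decode_int = int_decode"
instance proof
  fix x :: int
  have "decode (int_encode x) = x" by (simp add: decode_int_def)
  then show "\<exists>n. decode n = x" ..
qed
end

instantiation rat :: coded
begin
definition decode_rat :: "nat \<Rightarrow> rat" where "decode_rat = nat_to_rat_surj"
instance proof
  fix x :: rat
  show "\<exists>n. decode n = x"
    using surj_nat_to_rat_surj unfolding decode_rat_def surj_def by metis
qed
end

text \<open>
  Decodings are onto but need not be injective: a rational has many numerator-denominator pairs.
  Asking for a tracking function that is correct on every code of an argument keeps computability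
  closed under composition without a choice of canonical codes.
\<close>

definition computable :: "bool stream \<Rightarrow> ('a::coded \<Rightarrow> 'b::coded) \<Rightarrow> bool" where
  "computable A f \<longleftrightarrow> (\<exists>g. computable_nat A g \<and> (\<forall>n. f (decode n) = decode (g n)))"

lemma computable_nat_comp:
  assumes "computable_nat A f" "computable_nat A g"
  shows "computable_nat A (\<lambda>n. f (g n))"
  using partrec.comp[of A "\<lambda>n. Some (f n)" "\<lambda>n. Some (g n)"] assms
  by (simp add: computable_nat_def)

lemma computable_nat_pair:
  assumes "computable_nat A f" "computable_nat A g"
  shows "computable_nat A (\<lambda>n. prod_encode (f n, g n))"
  using partrec.pair[of A "\<lambda>n. Some (f n)" "\<lambda>n. Some (g n)"] assms
  by (simp add: computable_nat_def)

lemma computable_nat_fst: "computable_nat A (\<lambda>n. fst (prod_decode n))"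
  and computable_nat_snd: "computable_nat A (\<lambda>n. snd (prod_decode n))"
  and computable_nat_Suc: "computable_nat A Suc"
  by (auto simp: computable_nat_def intro: partrec.intros)

lemma computable_nat_id: "computable_nat A (\<lambda>n. n)"
  using computable_nat_pair[OF computable_nat_fst computable_nat_snd] by simp

lemma computable_nat_const: "computable_nat A (\<lambda>n. c)"
proof (induction c)
  case 0
  show ?case by (auto simp: computable_nat_def intro: partrec.intros)
next
  case (Suc c)
  show ?case using computable_nat_comp[OF computable_nat_Suc Suc] .
qed

text \<open>
  The recursion scheme of \<^const>\<open>partrec\<close> works on options and passes the parameter and the counter
  in one argument. On total functions it is primitive recursion with the whole argument \<open>n\<close> as
  parameter.
\<close>

lemma computable_nat_rec:
  assumes b: "computable_nat A b" and s: "computable_nat A s" and k: "computable_nat A k"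
  shows "computable_nat A
    (\<lambda>n. rec_nat (b n) (\<lambda>y r. s (prod_encode (n, prod_encode (y, r)))) (k n))"
proof -
  define h where
    "h n = (case prod_decode n of (a, k) \<Rightarrow>
      rec_nat (b a) (\<lambda>y r. s (prod_encode (a, prod_encode (y, r)))) k)" for n
  have "rec_nat (Some (b a))
        (\<lambda>y r. Option.bind r (\<lambda>i. Some (s (prod_encode (a, prod_encode (y, i)))))) k
      = Some (rec_nat (b a) (\<lambda>y r. s (prod_encode (a, prod_encode (y, r)))) k)" for a k
    by (induction k) auto
  then have "computable_nat A h"
    using partrec.prec[of A "\<lambda>n. Some (b n)" "\<lambda>n. Some (s n)"] b s
    unfolding computable_nat_def h_def by (simp add: case_prod_beta)
  from computable_nat_comp[OF this computable_nat_pair[OF computable_nat_id k]]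
  show ?thesis by (simp add: h_def)
qed

named_theorems computable_intros

lemma computableI_nat: "computable_nat A g \<Longrightarrow> (\<And>n. f (decode n) = decode (g n)) \<Longrightarrow> computable A f"
  unfolding computable_def by blast

lemma computableE:
  assumes "computable A f"
  obtains g where "computable_nat A g" "\<And>n. f (decode n) = decode (g n)"
  using assms unfolding computable_def by blast

lemma computable_nat_iff: "computable A f \<longleftrightarrow> computable_nat A f"
  for f :: "nat \<Rightarrow> nat"
  unfolding computable_def by (simp flip: fun_eq_iff)

lemma computable_id [computable_intros]: "computable A (\<lambda>x. x)"
  by (rule computableI_nat[OF computable_nat_id]) simp

lemma computable_const [computable_intros]: "computable A (\<lambda>x. c)"
proof -
  obtain n where "decode n = c" using decode_surj[of c] by blast
  then show ?thesis by (intro computableI_nat[OF computable_nat_const[of A n]]) simp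
qed

lemma computable_compose:
  assumes "computable A f" "computable A g"
  shows "computable A (\<lambda>x. f (g x))"
proof -
  from assms obtain F G where FG: "computable_nat A F" "\<And>n. f (decode n) = decode (F n)"
    "computable_nat A G" "\<And>n. g (decode n) = decode (G n)"
    unfolding computable_def by blast
  show ?thesis
    by (rule computableI_nat[OF computable_nat_comp[OF FG(1,3)]]) (simp add: FG)
qed

lemma computable_decode: "computable A (decode :: nat \<Rightarrow> 'a::coded)"
  by (rule computableI_nat[OF computable_nat_id]) simp

lemma computable_from_codes:
  "computable A (\<lambda>n::nat. f (decode n)) \<Longrightarrow> computable A f"
  unfolding computable_def by auto

lemma computable_Pair [computable_intros]:
  assumes "computable A f" "computable A g"
  shows "computable A (\<lambda>x. (f x, g x))"
proof -
  from assms obtain F G where FG: "computable_nat A F" "\<And>n. f (decode n) = decode (F n)"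
    "computable_nat A G" "\<And>n. g (decode n) = decode (G n)"
    unfolding computable_def by blast
  show ?thesis
    by (rule computableI_nat[OF computable_nat_pair[OF FG(1,3)]]) (simp add: FG decode_prod_def)
qed

lemma computable_fst [computable_intros]: "computable A f \<Longrightarrow> computable A (\<lambda>x. fst (f x))"
  by (rule computable_compose[of A fst])
    (rule computableI_nat[OF computable_nat_fst], simp add: decode_prod_def)

lemma computable_snd [computable_intros]: "computable A f \<Longrightarrow> computable A (\<lambda>x. snd (f x))"
  by (rule computable_compose[of A snd])
    (rule computableI_nat[OF computable_nat_snd], simp add: decode_prod_def)

lemma computable_rec_nat [computable_intros]:
  assumes "computable A b" "computable A (\<lambda>p. s (fst p) (fst (snd p)) (snd (snd p)))"
    "computable A k"
  shows "computable A (\<lambda>x. rec_nat (b x) (\<lambda>y r. s x y r) (k x))"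
proof -
  obtain B where B: "computable_nat A B" "\<And>n. b (decode n) = decode (B n)"
    using assms(1) by (rule computableE) blast
  obtain S where S: "computable_nat A S"
    "\<forall>n. (\<lambda>p. s (fst p) (fst (snd p)) (snd (snd p))) (decode n) = decode (S n)"
    using assms(2) unfolding computable_def by (elim exE conjE) (rule that)
  obtain K where K: "computable_nat A K" "\<And>n. k (decode n) = decode (K n)"
    using assms(3) by (rule computableE) blast
  have step: "s (decode a) y (decode r) = decode (S (prod_encode (a, prod_encode (y, r))))" for a y r
    using S(2)[rule_format, of "prod_encode (a, prod_encode (y, r))"] by (simp add: decode_prod_def)
  have "rec_nat (decode (B n)) (s (decode n)) m
      = decode (rec_nat (B n) (\<lambda>y r. S (prod_encode (n, prod_encode (y, r)))) m)" for n m
    by (induction m) (auto simp: step)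
  then show ?thesis
    by (intro computableI_nat[OF computable_nat_rec[OF B(1) S(1) K(1)]]) (simp add: B K)
qed

lemma computable_compose2:
  assumes s: "computable A (\<lambda>p. s (fst p) (snd p))" and "computable A f" "computable A g"
  shows "computable A (\<lambda>x. s (f x) (g x))"
  using computable_compose[OF s computable_Pair[OF assms(2,3)]] by simp

lemma computable_compose3:
  assumes s: "computable A (\<lambda>p. s (fst p) (fst (snd p)) (snd (snd p)))"
    and "computable A f" "computable A g" "computable A h"
  shows "computable A (\<lambda>x. s (f x) (g x) (h x))"
  using computable_compose[OF s computable_Pair[OF assms(2) computable_Pair[OF assms(3,4)]]] by simp

text \<open>
  A function out of a coded type may be computed by inspecting an arbitrary code of its argument;
  the result cannot depend on that code, because \<open>h\<close> only sees the decoded value.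
\<close>

lemma computable_on_codes:
  assumes h: "computable A (\<lambda>p::'x::coded \<times> nat. h (fst p) (decode (snd p) :: 'y::coded))"
    and f: "computable A f"
  shows "computable A (\<lambda>x. h x (f x))"
proof -
  from f obtain F where F: "computable_nat A F" "\<And>n. f (decode n) = decode (F n)"
    unfolding computable_def by blast
  have "computable A (\<lambda>n::nat. (decode n :: 'x, F n))"
    by (intro computable_Pair computable_decode) (simp add: computable_nat_iff F)
  from computable_compose[OF h this]
  have "computable A (\<lambda>n. h (decode n) (f (decode n)))" by (simp add: F)
  then show ?thesis by (rule computable_from_codes)
qed

subsection \<open>Booleans and natural numbers\<close>

lemma computable_Suc [computable_intros]: "computable A f \<Longrightarrow> computable A (\<lambda>x. Suc (f x))"
  by (rule computable_compose[of A Suc]) (simp_all add: computable_nat_iff computable_nat_Suc)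

lemma computable_prod_decode [computable_intros]:
  "computable A f \<Longrightarrow> computable A (\<lambda>x. prod_decode (f x))"
  by (rule computable_compose[of A prod_decode])
    (rule computableI_nat[OF computable_nat_id], simp_all add: decode_prod_def)

lemma computable_prod_encode [computable_intros]:
  "computable A f \<Longrightarrow> computable A (\<lambda>x. prod_encode (f x))"
  by (rule computable_compose[of A prod_encode])
    (rule computableI_nat[OF computable_nat_id], simp_all add: decode_prod_def)

lemma computable_add_nat [computable_intros]:
  assumes "computable A f" "computable A g"
  shows "computable A (\<lambda>x. f x + g x :: nat)"
proof -
  have "m + n = rec_nat m (\<lambda>_ r. Suc r) n" for m n :: nat by (induction n) auto
  then show ?thesis by (simp only:) (intro computable_intros assms)
qed

lemma computable_mult_nat [computable_intros]:
  assumes "computable A f" "computable A g"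
  shows "computable A (\<lambda>x. f x * g x :: nat)"
proof -
  have "m * n = rec_nat 0 (\<lambda>_ r. m + r) n" for m n :: nat by (induction n) auto
  then show ?thesis
    by (simp only:) (intro computable_intros assms computable_compose[of A f fst, OF assms(1)])
qed

lemma computable_diff_nat [computable_intros]:
  assumes "computable A f" "computable A g"
  shows "computable A (\<lambda>x. f x - g x :: nat)"
proof -
  have pred: "n - 1 = rec_nat 0 (\<lambda>y r. y) n" for n :: nat by (cases n) auto
  have "m - n = rec_nat m (\<lambda>_ r. rec_nat 0 (\<lambda>y r. y) r) n" for m n :: nat
    by (induction n) (auto simp flip: pred)
  then show ?thesis by (simp only:) (intro computable_intros assms)
qed

lemma computable_nonzero: "computable A f \<Longrightarrow> computable A (\<lambda>x. f x \<noteq> (0::nat))"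
  by (rule computable_compose[of A "\<lambda>n. n \<noteq> 0"])
    (rule computableI_nat[OF computable_nat_id], simp_all add: decode_bool_def)

lemma computable_if [computable_intros]:
  assumes b: "computable A b" and f: "computable A f" and g: "computable A g"
  shows "computable A (\<lambda>x. if b x then f x else g x)"
proof (rule computable_on_codes[where h = "\<lambda>x y. if y then f x else g x", OF _ b])
  have *: "(if decode n then u else v) = rec_nat v (\<lambda>_ _. u) n" for u v :: 'b and n
    by (cases n) (auto simp: decode_bool_def)
  have "computable A (\<lambda>p::'a \<times> nat. f (fst p))" "computable A (\<lambda>p::'a \<times> nat. g (fst p))"
    "computable A (\<lambda>p::('a \<times> nat) \<times> nat \<times> 'b. f (fst (fst p)))"
    by (rule computable_compose[OF f] computable_compose[OF g]; intro computable_intros)+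
  then show "computable A (\<lambda>p::'a \<times> nat. if decode (snd p) then f (fst p) else g (fst p))"
    unfolding * by (intro computable_intros)
qed

lemma computable_not [computable_intros]:
  assumes "computable A b"
  shows "computable A (\<lambda>x. \<not> b x)"
proof -
  have "(\<lambda>x. \<not> b x) = (\<lambda>x. if b x then False else True)" by auto
  then show ?thesis by (simp only:) (intro computable_intros assms)
qed

lemma computable_conj [computable_intros]:
  assumes "computable A b" "computable A c"
  shows "computable A (\<lambda>x. b x \<and> c x)"
proof -
  have "(\<lambda>x. b x \<and> c x) = (\<lambda>x. if b x then c x else False)" by auto
  then show ?thesis by (simp only:) (intro computable_intros assms)
qed

lemma computable_disj [computable_intros]:
  assumes "computable A b" "computable A c"
  shows "computable A (\<lambda>x. b x \<or> c x)"
  using computable_not[OF computable_conj[OF assms[THEN computable_not]]] by simp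

lemma computable_less_nat [computable_intros]:
  assumes "computable A f" "computable A g"
  shows "computable A (\<lambda>x. f x < (g x :: nat))"
  using computable_nonzero[OF computable_diff_nat[OF assms(2,1)]] by (simp add: not_le)

lemma computable_le_nat [computable_intros]:
  assumes "computable A f" "computable A g"
  shows "computable A (\<lambda>x. f x \<le> (g x :: nat))"
  using computable_not[OF computable_less_nat[OF assms(2,1)]] by (simp add: not_less)

lemma computable_eq_nat [computable_intros]:
  assumes "computable A f" "computable A g"
  shows "computable A (\<lambda>x. f x = (g x :: nat))"
  unfolding order.eq_iff by (intro computable_intros assms)

lemma computable_of_bool [computable_intros]:
  "computable A b \<Longrightarrow> computable A (\<lambda>x. of_bool (b x) :: nat)"
  unfolding of_bool_def by (intro computable_intros)

lemma computable_even [computable_intros]: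
  assumes "computable A f"
  shows "computable A (\<lambda>x. even (f x :: nat))"
proof -
  have "even n = rec_nat True (\<lambda>_ r. \<not> r) n" for n :: nat by (induction n) auto
  then show ?thesis by (simp only:) (intro computable_intros assms)
qed

lemma computable_div2 [computable_intros]:
  assumes "computable A f"
  shows "computable A (\<lambda>x. f x div 2 :: nat)"
proof -
  have "n div 2 = rec_nat 0 (\<lambda>y r. if even y then r else Suc r) n" for n :: nat
    by (induction n) auto
  then show ?thesis by (simp only:) (intro computable_intros assms)
qed

lemma computable_bex_nat [computable_intros]:
  assumes P: "computable A (\<lambda>p. P (fst p) (snd p))" and b: "computable A b"
  shows "computable A (\<lambda>x. \<exists>k<b x::nat. P x k)"
proof -
  have *: "(\<exists>k<n. P x k) = rec_nat False (\<lambda>k r. r \<or> P x k) n" for x n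
    by (induction n) (auto simp: less_Suc_eq)
  have "computable A (\<lambda>p::'a \<times> nat \<times> bool. P (fst p) (fst (snd p)))"
    using computable_compose[OF P, of "\<lambda>p. (fst p, fst (snd p))"]
    by (simp add: computable_intros)
  then show ?thesis unfolding * by (intro computable_intros b)
qed

lemma computable_ball_nat [computable_intros]:
  assumes P: "computable A (\<lambda>p. P (fst p) (snd p))" and b: "computable A b"
  shows "computable A (\<lambda>x. \<forall>k<b x::nat. P x k)"
proof -
  have "computable A (\<lambda>x. \<not> (\<exists>k<b x. \<not> P x k))" by (intro computable_intros assms)
  then show ?thesis by simp
qed

lemma computable_case_nat [computable_intros]:
  assumes "computable A k" "computable A z" "computable A (\<lambda>p. s (fst p) (snd p))"
  shows "computable A (\<lambda>x. case k x of 0 \<Rightarrow> z x | Suc m \<Rightarrow> s x m)"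
proof -
  have *: "(case k x of 0 \<Rightarrow> z x | Suc m \<Rightarrow> s x m) = (if k x = 0 then z x else s x (k x - 1))" for x
    by (cases "k x") auto
  have "computable A (\<lambda>x. s x (k x - 1))"
    using computable_compose[OF assms(3), of "\<lambda>x. (x, k x - 1)"]
    by (simp add: computable_intros assms)
  then show ?thesis unfolding * by (intro computable_intros assms)
qed

text \<open>
  Minimization of a decidable predicate terminates at the least witness.
\<close>

lemma computable_Least [computable_intros]:
  assumes R: "computable A (\<lambda>p. R (fst p) (snd p))" and ex: "\<And>x. \<exists>k. R x k"
  shows "computable A (\<lambda>x. LEAST k::nat. R x k)"
proof -
  have "computable A (\<lambda>p. if R (fst p) (snd p) then 0 else 1 :: nat)"
    by (intro computable_intros R)
  then obtain G where G: "computable_nat A G"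
    "\<forall>n. (\<lambda>p. if R (fst p) (snd p) then 0 else 1 :: nat) (decode n) = decode (G n)"
    unfolding computable_def by (elim exE conjE) (rule that)
  have G0: "G (prod_encode (n, k)) = 0 \<longleftrightarrow> R (decode n) k" for n k
    using G(2)[rule_format, of "prod_encode (n, k)"] by (auto simp: decode_prod_def split: if_splits)
  have "minimization (\<lambda>k. Some (G (prod_encode (n, k)))) = Some (LEAST k. R (decode n) k)" for n
    using ex by (auto simp: minimization_def G0)
  then have "computable_nat A (\<lambda>n. LEAST k. R (decode n) k)"
    using partrec.mn[of A "\<lambda>n. Some (G n)"] G(1) by (simp add: computable_nat_def)
  then show ?thesis by (rule computableI_nat) simp
qed

subsection \<open>Options and lists\<close>

lemma computable_Some [computable_intros]:
  "computable A f \<Longrightarrow> computable A (\<lambda>x. Some (f x))"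
  by (rule computable_compose[of A Some])
    (rule computableI_nat[OF computable_nat_Suc], simp_all add: decode_option_def)

lemma computable_case_option [computable_intros]:
  assumes f: "computable A f" and n: "computable A n"
    and s: "computable A (\<lambda>p. s (fst p) (snd p))"
  shows "computable A (\<lambda>x. case f x of None \<Rightarrow> n x | Some y \<Rightarrow> s x y)"
proof (rule computable_on_codes[OF _ f])
  have *: "(case decode k of None \<Rightarrow> n x | Some y \<Rightarrow> s x y)
      = (if k = 0 then n x else s x (decode (k - 1)))" for k x
    by (auto simp: decode_option_def)
  have "computable A (\<lambda>p::'a \<times> nat. s (fst p) (decode (snd p - 1)))"
    by (intro computable_compose2[OF s] computable_compose[OF computable_decode] computable_intros)
  moreover have "computable A (\<lambda>p::'a \<times> nat. n (fst p))"
    by (rule computable_compose[OF n]) (intro computable_intros)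
  ultimately show "computable A
      (\<lambda>p::'a \<times> nat. case decode (snd p) of None \<Rightarrow> n (fst p) | Some y \<Rightarrow> s (fst p) y)"
    unfolding * by (intro computable_intros)
qed

lemma computable_bind [computable_intros]:
  assumes "computable A f" "computable A (\<lambda>p. s (fst p) (snd p))"
  shows "computable A (\<lambda>x. Option.bind (f x) (s x))"
proof -
  have "Option.bind r t = (case r of None \<Rightarrow> None | Some y \<Rightarrow> t y)" for r and t :: "'b \<Rightarrow> 'c option"
    by (cases r) auto
  then show ?thesis by (simp only:) (intro computable_intros assms)
qed

lemma computable_Cons [computable_intros]:
  assumes "computable A f" "computable A g"
  shows "computable A (\<lambda>x. f x # g x)"
proof -
  have "computable A (\<lambda>p::'b \<times> 'b list. fst p # snd p)"
  proof (rule computableI_nat[OF computable_nat_Suc])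
    fix n
    show "fst (decode n) # snd (decode n) = (decode (Suc n) :: 'b list)"
      by (simp add: decode_prod_def decode_list_def case_prod_beta)
  qed
  then show ?thesis by (rule computable_compose2[OF _ assms])
qed

lemma computable_tl [computable_intros]:
  assumes "computable A f"
  shows "computable A (\<lambda>x. tl (f x))"
proof -
  have "computable_nat A (\<lambda>n. snd (prod_decode (n - 1)))"
    by (simp only: computable_nat_iff[symmetric]) (intro computable_intros)
  moreover have "tl (decode n) = (decode (snd (prod_decode (n - 1))) :: 'b list)" for n
  proof (cases n)
    case 0
    have "prod_decode 0 = (0, 0)" by (simp add: prod_decode_def prod_decode_aux.simps)
    then show ?thesis by (simp add: decode_list_def 0)
  qed (simp add: decode_list_def case_prod_beta)
  ultimately have "computable A (tl :: 'b list \<Rightarrow> _)" by (rule computableI_nat)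
  then show ?thesis by (rule computable_compose[OF _ assms])
qed

lemma length_list_decode_le: "length (list_decode n) \<le> n"
proof (induction n rule: less_induct)
  case (less n)
  show ?case
  proof (cases n)
    case (Suc m)
    have "snd (prod_decode m) < n"
      using le_prod_encode_2[of "snd (prod_decode m)" "fst (prod_decode m)"] Suc by simp
    from less[OF this] this show ?thesis by (simp add: Suc case_prod_beta)
  qed simp
qed

text \<open>
  A fold iterates one step on pairs of a list code and an accumulator. The code of a list bounds
  its length, so the code itself serves as the number of iterations.
\<close>

lemma computable_foldl [computable_intros]:
  assumes s: "computable A (\<lambda>p. s (fst p) (fst (snd p)) (snd (snd p)))"
    and i: "computable A i" and l: "computable A l"
  shows "computable A (\<lambda>x. foldl (\<lambda>a b. s x a b) (i x) (l x))"
proof (rule computable_on_codes[OF _ l])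
  define step :: "_ \<Rightarrow> nat \<times> _ \<Rightarrow> nat \<times> _" where
    "step x p = (case fst p of 0 \<Rightarrow> p
      | Suc m \<Rightarrow> (snd (prod_decode m), s x (snd p) (decode (fst (prod_decode m)))))" for x p
  have foldl_step: "length (list_decode c) \<le> k \<Longrightarrow>
      snd (rec_nat (c, a) (\<lambda>_ r. step x r) k) = foldl (s x) a (map decode (list_decode c))"
    for x c a k
  proof -
    have "length (list_decode c) \<le> k \<Longrightarrow>
      snd ((step x ^^ k) (c, a)) = foldl (s x) a (map decode (list_decode c))"
    proof (induction k arbitrary: c a)
      case 0
      then show ?case by simp
    next
      case (Suc k)
      then show ?case
        by (cases c) (auto simp: funpow_Suc_right step_def case_prod_beta simp del: funpow.simps)
    qed
    moreover have "rec_nat (c, a) (\<lambda>_ r. step x r) k = (step x ^^ k) (c, a)" for k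
      by (induction k) auto
    ultimately show "length (list_decode c) \<le> k \<Longrightarrow>
      snd (rec_nat (c, a) (\<lambda>_ r. step x r) k) = foldl (s x) a (map decode (list_decode c))"
      by simp
  qed
  have *: "foldl (s x) a (decode c) = snd (rec_nat (c, a) (\<lambda>_ r. step x r) c)" for x a c
    by (simp add: foldl_step[OF length_list_decode_le] decode_list_def)
  note decode' = computable_compose[OF computable_decode]
  show "computable A (\<lambda>p::_ \<times> nat. foldl (s (fst p)) (i (fst p)) (decode (snd p)))"
    unfolding * step_def
    by (intro computable_intros computable_compose[OF i] computable_compose3[OF s] decode')
qed

lemma computable_length [computable_intros]:
  assumes "computable A f"
  shows "computable A (\<lambda>x. length (f x))"
proof -
  have "foldl (\<lambda>a b. Suc a) k l = k + length l" for l :: "'b list" and k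
    by (induction l arbitrary: k) auto
  from this[of 0] have "length l = foldl (\<lambda>a b. Suc a) 0 l" for l :: "'b list" by simp
  then show ?thesis by (simp only:) (intro computable_intros assms)
qed

lemma computable_rev [computable_intros]:
  assumes "computable A f"
  shows "computable A (\<lambda>x. rev (f x))"
proof -
  have "foldl (\<lambda>a b. b # a) k l = rev l @ k" for l k :: "'b list"
    by (induction l arbitrary: k) auto
  from this[of "[]"] have "rev l = foldl (\<lambda>a b. b # a) [] l" for l :: "'b list" by simp
  then show ?thesis by (simp only:) (intro computable_intros assms)
qed

lemma computable_append [computable_intros]:
  assumes "computable A f" "computable A g"
  shows "computable A (\<lambda>x. f x @ g x)"
proof -
  have "foldl (\<lambda>a b. b # a) k l = rev l @ k" for l k :: "'b list"
    by (induction l arbitrary: k) auto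
  from this[of k "rev l" for k l] have "l @ k = foldl (\<lambda>a b. b # a) k (rev l)" for l k :: "'b list"
    by simp
  then show ?thesis by (simp only:) (intro computable_intros assms)
qed

lemma computable_map [computable_intros]:
  assumes "computable A (\<lambda>p. f (fst p) (snd p))" "computable A l"
  shows "computable A (\<lambda>x. map (f x) (l x))"
proof -
  have fold: "foldl (\<lambda>a b. a @ [g b]) k l = k @ map g l" for l k and g :: "'b \<Rightarrow> 'c"
    by (induction l arbitrary: k) auto
  have *: "map g l = foldl (\<lambda>a b. a @ [g b]) [] l" for l and g :: "'b \<Rightarrow> 'c"
    using fold[of g "[]"] by simp
  have "computable A (\<lambda>p::'a \<times> 'c list \<times> 'b. f (fst p) (snd (snd p)))"
    by (intro computable_compose2[OF assms(1)] computable_intros)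
  then show ?thesis unfolding * by (intro computable_intros assms)
qed

lemma computable_drop [computable_intros]:
  assumes "computable A k" "computable A l"
  shows "computable A (\<lambda>x. drop (k x) (l x))"
proof -
  have "drop n l = rec_nat l (\<lambda>_ r. tl r) n" for n and l :: "'b list"
    by (induction n) (simp_all add: drop_Suc drop_tl)
  then show ?thesis by (simp only:) (intro computable_intros assms)
qed

lemma computable_take [computable_intros]:
  assumes "computable A k" "computable A l"
  shows "computable A (\<lambda>x. take (k x) (l x))"
proof -
  have "take n l = rev (drop (length l - n) (rev l))" for n and l :: "'b list"
    by (cases "n \<le> length l") (simp_all add: drop_rev)
  then show ?thesis by (simp only:) (intro computable_intros assms)
qed

lemma computable_concat [computable_intros]:
  assumes "computable A l"
  shows "computable A (\<lambda>x. concat (l x))"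
proof -
  have fold: "foldl (\<lambda>a b. a @ b) k l = k @ concat l" for l and k :: "'b list"
    by (induction l arbitrary: k) auto
  have *: "concat l = foldl (\<lambda>a b. a @ b) [] l" for l :: "'b list list"
    using fold[of "[]"] by simp
  show ?thesis unfolding * by (intro computable_intros assms)
qed

lemma computable_ball_list [computable_intros]:
  assumes P: "computable A (\<lambda>p. P (fst p) (snd p))" and l: "computable A l"
  shows "computable A (\<lambda>x. \<forall>y\<in>set (l x). P x y)"
proof -
  have fold: "foldl (\<lambda>a b. a \<and> Q b) k l \<longleftrightarrow> k \<and> (\<forall>y\<in>set l. Q y)" for l k and Q :: "'b \<Rightarrow> bool"
    by (induction l arbitrary: k) auto
  have *: "(\<forall>y\<in>set l. Q y) = foldl (\<lambda>a b. a \<and> Q b) True l" for l and Q :: "'b \<Rightarrow> bool"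
    using fold[of Q True] by simp
  have "computable A (\<lambda>p::'a \<times> bool \<times> 'b. P (fst p) (snd (snd p)))"
    by (intro computable_compose2[OF P] computable_intros)
  then show ?thesis unfolding * by (intro computable_intros l)
qed

lemma computable_list_encode:
  "computable A f \<Longrightarrow> computable A (\<lambda>x. list_encode (f x))"
  by (rule computable_compose[of A list_encode])
    (rule computableI_nat[OF computable_nat_id], simp_all add: decode_list_def map_idI)

lemma computable_string_code [computable_intros]:
  assumes "computable A f"
  shows "computable A (\<lambda>x. string_code (f x))"
  unfolding string_code_def by (intro computable_list_encode computable_intros assms)

lemma decode_string_code [simp]: "decode (string_code \<sigma>) = \<sigma>"
  by (simp add: string_code_def decode_list_def decode_bool_def comp_def)

lemma string_code_eq_iff [simp]: "string_code \<sigma> = string_code \<tau> \<longleftrightarrow> \<sigma> = \<tau>"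
  by (metis decode_string_code)

lemma computable_eq_string [computable_intros]:
  assumes "computable A f" "computable A g"
  shows "computable A (\<lambda>x. f x = (g x :: bool list))"
proof -
  have "computable A (\<lambda>x. string_code (f x) = string_code (g x))"
    by (intro computable_intros assms)
  then show ?thesis by simp
qed

lemma computable_prefix [computable_intros]:
  assumes "computable A f" "computable A g"
  shows "computable A (\<lambda>x. prefix (f x) (g x :: bool list))"
proof -
  have "prefix \<sigma> \<tau> \<longleftrightarrow> take (length \<sigma>) \<tau> = \<sigma>" for \<sigma> \<tau> :: "bool list"
    by (metis append_eq_conv_conj prefix_def take_is_prefix)
  then show ?thesis by (simp only:) (intro computable_intros assms)
qed

subsection \<open>Integers and rationals\<close>

lemma decode_int: "decode n = (if even n then int (n div 2) else - int (n div 2) - 1)"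
  by (simp add: decode_int_def int_decode_def sum_decode_def)

text \<open>
  All integer arithmetic reduces to differences of natural numbers, where the two halves of the
  coding by even and odd numbers are easily told apart.
\<close>

lemma computable_int_diff:
  assumes "computable A f" "computable A g"
  shows "computable A (\<lambda>x. int (f x) - int (g x))"
proof -
  define c :: "nat \<Rightarrow> nat" where
    "c p = (if snd (prod_decode p) \<le> fst (prod_decode p)
      then 2 * (fst (prod_decode p) - snd (prod_decode p))
      else Suc (2 * (snd (prod_decode p) - fst (prod_decode p) - 1)))" for p
  have "computable A c" unfolding c_def by (intro computable_intros)
  then have "computable A (\<lambda>p::nat \<times> nat. int (fst p) - int (snd p))"
    by (intro computableI_nat[where g = c])
      (auto simp: computable_nat_iff c_def decode_int decode_prod_def of_nat_diff)
  then show ?thesis by (rule computable_compose2[OF _ assms])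
qed

lemma computable_nat_of_int [computable_intros]:
  "computable A f \<Longrightarrow> computable A (\<lambda>x. nat (f x))"
proof (rule computable_compose[of A nat])
  have "computable A (\<lambda>n. if even n then n div 2 else 0 :: nat)" by (intro computable_intros)
  then show "computable A nat"
    by (intro computableI_nat[where g = "\<lambda>n. if even n then n div 2 else 0"])
      (auto simp: decode_int computable_nat_iff)
qed

lemma computable_nat_uminus:
  "computable A f \<Longrightarrow> computable A (\<lambda>x. nat (- f x))"
proof (rule computable_compose[of A "\<lambda>z. nat (- z)"])
  have "computable A (\<lambda>n. if even n then 0 else Suc (n div 2))" by (intro computable_intros)
  then show "computable A (\<lambda>z. nat (- z))"
    by (intro computableI_nat[where g = "\<lambda>n. if even n then 0 else Suc (n div 2)"])
      (auto simp: decode_int computable_nat_iff)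
qed

lemma computable_int [computable_intros]:
  assumes "computable A f"
  shows "computable A (\<lambda>x. int (f x))"
  using computable_int_diff[OF assms computable_const[of A 0]] by simp

lemma computable_uminus_int [computable_intros]:
  assumes "computable A f"
  shows "computable A (\<lambda>x. - f x :: int)"
proof -
  have *: "(\<lambda>x. - f x) = (\<lambda>x. int (nat (- f x)) - int (nat (f x)))" by auto
  show ?thesis by (subst *) (intro computable_int_diff computable_nat_uminus computable_intros assms)
qed

lemma computable_add_int [computable_intros]:
  assumes "computable A f" "computable A g"
  shows "computable A (\<lambda>x. f x + g x :: int)"
proof -
  have "y + z = int (nat y + nat z) - int (nat (- y) + nat (- z))" for y z by simp
  then show ?thesis by (simp only:) (intro computable_int_diff computable_nat_uminus computable_intros assms)
qed

lemma computable_mult_int [computable_intros]: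
  assumes "computable A f" "computable A g"
  shows "computable A (\<lambda>x. f x * g x :: int)"
proof -
  have "y * z = int (nat y * nat z + nat (- y) * nat (- z)) - int (nat y * nat (- z) + nat (- y) * nat z)" for y z
    by (cases "y \<ge> 0"; cases "z \<ge> 0") (simp_all add: algebra_simps)
  then show ?thesis by (simp only:) (intro computable_int_diff computable_nat_uminus computable_intros assms)
qed

lemma computable_pos_int [computable_intros]:
  assumes "computable A f"
  shows "computable A (\<lambda>x. 0 < (f x :: int))"
proof -
  have "0 < z \<longleftrightarrow> 0 < nat z" for z by simp
  then show ?thesis by (simp only:) (intro computable_intros assms)
qed

lemma computable_eq0_int [computable_intros]:
  assumes "computable A f"
  shows "computable A (\<lambda>x. (f x :: int) = 0)"
proof -
  have "z = 0 \<longleftrightarrow> \<not> 0 < z \<and> \<not> 0 < - z" for z :: int by auto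
  then show ?thesis by (simp only:) (intro computable_intros assms)
qed

definition fract :: "int \<times> int \<Rightarrow> rat" where "fract p = Fract (fst p) (snd p)"

text \<open>
  The codes of rationals are the codes of pairs of integers. So an operation on rationals is
  computable as soon as it comes from an operation on raw, possibly unreduced or degenerate,
  fractions.
\<close>

lemma decode_rat_eq: "decode n = fract (decode n)"
  by (simp add: decode_rat_def nat_to_rat_surj_def fract_def decode_prod_def decode_int_def Let_def case_prod_beta)

lemma computable_fract: "computable A f \<Longrightarrow> computable A (\<lambda>x. fract (f x))"
  by (rule computable_compose[of A fract])
    (rule computableI_nat[OF computable_nat_id], simp_all add: decode_rat_eq)

lemma computable_on_fract:
  assumes h: "computable A (\<lambda>p::'x::coded \<times> int \<times> int. h (fst p) (fract (snd p)))"
    and f: "computable A f"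
  shows "computable A (\<lambda>x. h x (f x))"
proof (rule computable_on_codes[OF _ f])
  have "computable A (\<lambda>p::'x \<times> nat. h (fst p) (fract (decode (snd p))))"
    by (rule computable_compose2[OF h]) (intro computable_intros computable_compose[OF computable_decode])+
  then show "computable A (\<lambda>p::'x \<times> nat. h (fst p) (decode (snd p)))"
    by (simp only: decode_rat_eq)
qed

lemma computable_on_fract2:
  assumes h: "computable A (\<lambda>p::(int \<times> int) \<times> int \<times> int. h (fract (fst p)) (fract (snd p)))"
    and f: "computable A f" and g: "computable A g"
  shows "computable A (\<lambda>x. h (f x) (g x))"
proof -
  have "computable A (\<lambda>p::rat \<times> int \<times> int. h (fst p) (fract (snd p)))"
  proof -
    have "computable A (\<lambda>q::(rat \<times> int \<times> int) \<times> int \<times> int. h (fract (snd q)) (fract (snd (fst q))))"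
      by (rule computable_compose2[OF h]) (intro computable_intros)+
    then show ?thesis
      by (rule computable_on_fract[where h = "\<lambda>p r. h r (fract (snd p))"]) (intro computable_intros)
  qed
  then have "computable A (\<lambda>q::(rat \<times> rat) \<times> int \<times> int. h (fst (fst q)) (fract (snd q)))"
    by (rule computable_compose2) (intro computable_intros)+
  then have "computable A (\<lambda>p. h (fst p) (snd p))"
    by (rule computable_on_fract[where h = "\<lambda>p. h (fst p)"]) (intro computable_intros)
  then show ?thesis by (rule computable_compose2[OF _ f g])
qed

lemma computable_add_rat [computable_intros]:
  assumes "computable A f" "computable A g"
  shows "computable A (\<lambda>x. f x + g x :: rat)"
proof (rule computable_on_fract2[OF _ assms])
  \<comment> \<open>\<open>Fract a 0\<close> is \<open>0\<close>, where the usual formula for sums of fractions fails.\<close>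
  have *: "fract p + fract q = fract (if snd p = 0 then q else if snd q = 0 then p
      else (fst p * snd q + fst q * snd p, snd p * snd q))" for p q
    by (auto simp: fract_def rat_number_collapse)
  show "computable A (\<lambda>p. fract (fst p) + fract (snd p))"
    unfolding * by (intro computable_fract computable_intros)
qed

lemma computable_mult_rat [computable_intros]:
  assumes "computable A f" "computable A g"
  shows "computable A (\<lambda>x. f x * g x :: rat)"
proof (rule computable_on_fract2[OF _ assms])
  have *: "fract p * fract q = fract (fst p * fst q, snd p * snd q)" for p q
    by (simp add: fract_def)
  show "computable A (\<lambda>p. fract (fst p) * fract (snd p))"
    unfolding * by (intro computable_fract computable_intros)
qed

lemma computable_uminus_rat [computable_intros]:
  assumes "computable A f"
  shows "computable A (\<lambda>x. - f x :: rat)"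
proof -
  have *: "(\<lambda>x. - f x) = (\<lambda>x. (- 1) * f x)" by auto
  show ?thesis by (subst *) (intro computable_intros assms)
qed

lemma computable_diff_rat [computable_intros]:
  assumes "computable A f" "computable A g"
  shows "computable A (\<lambda>x. f x - g x :: rat)"
  unfolding diff_conv_add_uminus by (intro computable_intros assms)

lemma computable_inverse_rat [computable_intros]:
  assumes "computable A f"
  shows "computable A (\<lambda>x. inverse (f x) :: rat)"
proof (rule computable_on_fract[OF _ assms])
  have *: "inverse (fract p) = fract (snd p, fst p)" for p
    by (simp add: fract_def)
  show "computable A (\<lambda>p::_ \<times> int \<times> int. inverse (fract (snd p)))"
    unfolding * by (intro computable_fract computable_intros)
qed

lemma computable_divide_rat [computable_intros]:
  assumes "computable A f" "computable A g"
  shows "computable A (\<lambda>x. f x / g x :: rat)"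
  unfolding divide_inverse by (intro computable_intros assms)

lemma computable_less_rat [computable_intros]:
  assumes "computable A f" "computable A g"
  shows "computable A (\<lambda>x. f x < (g x :: rat))"
proof -
  \<comment> \<open>This also holds for zero denominators: then both sides are false.\<close>
  have *: "0 < fract p \<longleftrightarrow> 0 < fst p * snd p" for p
    by (simp add: fract_def Fract_of_int_quotient zero_less_divide_iff zero_less_mult_iff)
  have "computable A (\<lambda>x. 0 < g x - f x)"
  proof (rule computable_on_fract[where h = "\<lambda>_ r. 0 < r"])
    show "computable A (\<lambda>p::_ \<times> int \<times> int. 0 < fract (snd p))"
      unfolding * by (intro computable_intros)
  qed (intro computable_intros assms)
  then show ?thesis by simp
qed

lemma computable_le_rat [computable_intros]:
  assumes "computable A f" "computable A g"
  shows "computable A (\<lambda>x. f x \<le> (g x :: rat))"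
  using computable_not[OF computable_less_rat[OF assms(2,1)]] by (simp add: not_less)

lemma computable_of_nat_rat [computable_intros]:
  assumes "computable A f"
  shows "computable A (\<lambda>x. of_nat (f x) :: rat)"
proof -
  have "of_nat n = fract (int n, 1)" for n by (simp add: fract_def of_nat_rat)
  then show ?thesis by (simp only:) (intro computable_fract computable_intros assms)
qed

lemma computable_power_rat [computable_intros]:
  assumes "computable A f" "computable A k"
  shows "computable A (\<lambda>x. f x ^ k x :: rat)"
proof -
  have *: "r ^ n = rec_nat 1 (\<lambda>_ s. r * s) n" for r :: rat and n
    by (induction n) auto
  have "computable A (\<lambda>p::'a \<times> nat \<times> rat. f (fst p))"
    by (rule computable_compose[OF assms(1)]) (intro computable_intros)
  then show ?thesis unfolding * by (intro computable_intros assms)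
qed

lemma computable_sum_rat [computable_intros]:
  assumes f: "computable A (\<lambda>p. f (fst p) (snd p))" and k: "computable A k"
  shows "computable A (\<lambda>x. \<Sum>i<k x::nat. f x i :: rat)"
proof -
  have *: "(\<Sum>i<n. g i) = rec_nat 0 (\<lambda>i s. s + g i) n" for n and g :: "nat \<Rightarrow> rat"
    by (induction n) auto
  have "computable A (\<lambda>p::'a \<times> nat \<times> rat. f (fst p) (fst (snd p)))"
    by (intro computable_compose2[OF f] computable_intros)
  then show ?thesis unfolding * by (intro computable_intros k)
qed

lemma computable_sum_list_rat [computable_intros]:
  assumes f: "computable A (\<lambda>p. f (fst p) (snd p))" and l: "computable A l"
  shows "computable A (\<lambda>x. \<Sum>y\<leftarrow>l x. f x y :: rat)"
proof -
  have fold: "foldl (\<lambda>s y. s + g y) k l = k + (\<Sum>y\<leftarrow>l. g y)" for l k and g :: "'b \<Rightarrow> rat"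
    by (induction l arbitrary: k) (auto simp: algebra_simps)
  have *: "(\<Sum>y\<leftarrow>l. g y) = foldl (\<lambda>s y. s + g y) 0 l" for l and g :: "'b \<Rightarrow> rat"
    using fold[of g 0] by simp
  have "computable A (\<lambda>p::'a \<times> rat \<times> 'b. f (fst p) (snd (snd p)))"
    by (intro computable_compose2[OF f] computable_intros)
  then show ?thesis unfolding * by (intro computable_intros l)
qed

section \<open>Semidecidable predicates\<close>

text \<open>
  \<open>F n s\<close> is the outcome of running \<open>\<phi>\<close> on input \<open>n\<close> for \<open>s\<close> stages. Such approximations are
  built by recursion over the closure rules of \<^const>\<open>partrec\<close>; this gives dovetailing without
  a universal machine.
\<close>

definition approximates :: "bool stream \<Rightarrow> (nat \<Rightarrow> nat option) \<Rightarrow> (nat \<Rightarrow> nat \<Rightarrow> nat option) \<Rightarrow> bool" where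
  "approximates A \<phi> F \<longleftrightarrow> computable A (\<lambda>p. F (fst p) (snd p)) \<and>
    (\<forall>n y. \<phi> n = Some y \<longleftrightarrow> (\<exists>s. F n s = Some y)) \<and>
    (\<forall>n s t y. F n s = Some y \<longrightarrow> s \<le> t \<longrightarrow> F n t = Some y)"

lemma approximatesD:
  assumes "approximates A f F"
  shows "computable A (\<lambda>p. F (fst p) (snd p))"
    and "f n = Some y \<longleftrightarrow> (\<exists>s. F n s = Some y)"
    and "F n s = Some y \<Longrightarrow> s \<le> t \<Longrightarrow> F n t = Some y"
  using assms unfolding approximates_def by blast+

lemma approximatesI:
  assumes "computable A (\<lambda>p. F (fst p) (snd p))"
    and "\<And>n y. f n = Some y \<longleftrightarrow> (\<exists>s. F n s = Some y)"
    and "\<And>n s t y. F n s = Some y \<Longrightarrow> s \<le> t \<Longrightarrow> F n t = Some y"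
  shows "approximates A f F"
  using assms unfolding approximates_def by blast

lemma approximates_total:
  assumes "partrec A (\<lambda>n. Some (g n))"
  shows "approximates A (\<lambda>n. Some (g n)) (\<lambda>n s. Some (g n))"
proof -
  have "computable A g" using assms by (simp add: computable_nat_iff computable_nat_def)
  then have "computable A (\<lambda>p::nat \<times> nat. g (fst p))"
    by (rule computable_compose) (intro computable_intros)
  then show ?thesis by (simp add: approximates_def computable_intros)
qed

lemma approximates_comp:
  assumes f: "approximates A f F" and g: "approximates A g G"
  shows "approximates A (\<lambda>n. Option.bind (g n) f) (\<lambda>n s. Option.bind (G n s) (\<lambda>a. F a s))"
proof -
  note cF = approximatesD(1)[OF f] and F = approximatesD(2)[OF f] and mF = approximatesD(3)[OF f]
  note cG = approximatesD(1)[OF g] and G = approximatesD(2)[OF g] and mG = approximatesD(3)[OF g]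
  have "computable A (\<lambda>p. Option.bind (G (fst p) (snd p)) (\<lambda>a. F a (snd p)))"
    by (intro computable_bind cG computable_compose2[OF cF] computable_intros)
  moreover have "Option.bind (g n) f = Some y \<longleftrightarrow> (\<exists>s. Option.bind (G n s) (\<lambda>a. F a s) = Some y)"
    for n y
  proof
    assume "Option.bind (g n) f = Some y"
    then obtain a s t where "G n s = Some a" "F a t = Some y"
      by (auto simp: bind_eq_Some_conv F G)
    then have "G n (max s t) = Some a" "F a (max s t) = Some y"
      by (auto intro: mF mG)
    then show "\<exists>s. Option.bind (G n s) (\<lambda>a. F a s) = Some y" by (intro exI[of _ "max s t"]) simp
  next
    assume "\<exists>s. Option.bind (G n s) (\<lambda>a. F a s) = Some y"
    then obtain s a where "G n s = Some a" "F a s = Some y" by (auto simp: bind_eq_Some_conv)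
    then have "g n = Some a" "f a = Some y" unfolding F G by blast+
    then show "Option.bind (g n) f = Some y" by simp
  qed
  moreover have "Option.bind (G n t) (\<lambda>a. F a t) = Some y"
    if st: "Option.bind (G n s) (\<lambda>a. F a s) = Some y" "s \<le> t" for n s t y
  proof -
    obtain a where "G n s = Some a" "F a s = Some y" using st(1) by (auto simp: bind_eq_Some_conv)
    then have "G n t = Some a" "F a t = Some y" using st(2) mF mG by blast+
    then show ?thesis by simp
  qed
  ultimately show ?thesis by (rule approximatesI)
qed

lemma approximates_pair:
  assumes f: "approximates A f F" and g: "approximates A g G"
  shows "approximates A
    (\<lambda>n. Option.bind (f n) (\<lambda>a. Option.bind (g n) (\<lambda>b. Some (prod_encode (a, b)))))
    (\<lambda>n s. Option.bind (F n s) (\<lambda>a. Option.bind (G n s) (\<lambda>b. Some (prod_encode (a, b)))))"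
proof -
  note cF = approximatesD(1)[OF f] and F = approximatesD(2)[OF f] and mF = approximatesD(3)[OF f]
  note cG = approximatesD(1)[OF g] and G = approximatesD(2)[OF g] and mG = approximatesD(3)[OF g]
  have "computable A (\<lambda>p. Option.bind (F (fst p) (snd p))
      (\<lambda>a. Option.bind (G (fst p) (snd p)) (\<lambda>b. Some (prod_encode (a, b)))))"
    by (intro computable_bind cF computable_compose2[OF cG] computable_intros)
  moreover have "f n = Some a \<and> g n = Some b \<longleftrightarrow> (\<exists>s. F n s = Some a \<and> G n s = Some b)"
    for n a b
  proof
    assume "f n = Some a \<and> g n = Some b"
    then obtain s t where "F n s = Some a" "G n t = Some b" by (auto simp: F G)
    then have "F n (max s t) = Some a" "G n (max s t) = Some b" by (auto intro: mF mG)
    then show "\<exists>s. F n s = Some a \<and> G n s = Some b" by blast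
  qed (auto simp: F G)
  then have "Option.bind (f n) (\<lambda>a. Option.bind (g n) (\<lambda>b. Some (prod_encode (a, b)))) = Some y
    \<longleftrightarrow> (\<exists>s. Option.bind (F n s) (\<lambda>a. Option.bind (G n s) (\<lambda>b. Some (prod_encode (a, b)))) = Some y)"
    for n y unfolding bind_eq_Some_conv by blast
  moreover have "Option.bind (F n t) (\<lambda>a. Option.bind (G n t) (\<lambda>b. Some (prod_encode (a, b)))) = Some y"
    if st: "Option.bind (F n s) (\<lambda>a. Option.bind (G n s) (\<lambda>b. Some (prod_encode (a, b)))) = Some y" "s \<le> t"
    for n s t y
  proof -
    obtain a b where "F n s = Some a" "G n s = Some b" "y = prod_encode (a, b)"
      using st(1) by (auto simp: bind_eq_Some_conv)
    then have "F n t = Some a" "G n t = Some b" using st(2) mF mG by blast+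
    then show ?thesis using \<open>y = _\<close> by simp
  qed
  ultimately show ?thesis by (rule approximatesI)
qed

text \<open>
  All calls inside the recursion receive the same number \<open>s\<close> of stages. A converging recursion
  makes finitely many calls, and monotonicity lets them share one sufficiently large \<open>s\<close>.
\<close>

lemma approximates_prec:
  assumes f: "approximates A f F" and g: "approximates A g G"
  shows "approximates A
    (\<lambda>n. case prod_decode n of (a, k) \<Rightarrow>
      rec_nat (f a) (\<lambda>y r. Option.bind r (\<lambda>i. g (prod_encode (a, prod_encode (y, i))))) k)
    (\<lambda>n s. rec_nat (F (fst (prod_decode n)) s)
      (\<lambda>y r. Option.bind r (\<lambda>i. G (prod_encode (fst (prod_decode n), prod_encode (y, i))) s))
      (snd (prod_decode n)))"
proof -
  note cF = approximatesD(1)[OF f] and F = approximatesD(2)[OF f] and mF = approximatesD(3)[OF f]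
  note cG = approximatesD(1)[OF g] and G = approximatesD(2)[OF g] and mG = approximatesD(3)[OF g]
  define h where "h a k = rec_nat (f a)
      (\<lambda>y r. Option.bind r (\<lambda>i. g (prod_encode (a, prod_encode (y, i))))) k" for a k
  define H where "H a s k = rec_nat (F a s)
      (\<lambda>y r. Option.bind r (\<lambda>i. G (prod_encode (a, prod_encode (y, i))) s)) k" for a s k
  have mH: "H a s k = Some y \<Longrightarrow> s \<le> t \<Longrightarrow> H a t k = Some y" for a s t k y
  proof (induction k arbitrary: y)
    case 0
    then show ?case using mF[of a s y t] by (simp add: H_def)
  next
    case (Suc k)
    then obtain i where "H a s k = Some i" "G (prod_encode (a, prod_encode (k, i))) s = Some y"
      by (auto simp: H_def bind_eq_Some_conv)
    then have "H a t k = Some i" "G (prod_encode (a, prod_encode (k, i))) t = Some y"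
      using Suc by (auto intro: mG)
    then show ?case by (simp add: H_def)
  qed
  have hH: "h a k = Some y \<longleftrightarrow> (\<exists>s. H a s k = Some y)" for a k y
  proof (induction k arbitrary: y)
    case 0
    then show ?case by (simp add: H_def h_def F)
  next
    case (Suc k)
    have "h a (Suc k) = Some y \<longleftrightarrow> (\<exists>i. h a k = Some i \<and> g (prod_encode (a, prod_encode (k, i))) = Some y)"
      by (simp add: h_def bind_eq_Some_conv)
    also have "\<dots> \<longleftrightarrow> (\<exists>i s t. H a s k = Some i \<and> G (prod_encode (a, prod_encode (k, i))) t = Some y)"
      by (auto simp: Suc G)
    also have "\<dots> \<longleftrightarrow> (\<exists>s i. H a s k = Some i \<and> G (prod_encode (a, prod_encode (k, i))) s = Some y)"
      by (meson mG mH nat_le_linear)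
    also have "\<dots> \<longleftrightarrow> (\<exists>s. H a s (Suc k) = Some y)"
      by (simp add: H_def bind_eq_Some_conv)
    finally show ?case .
  qed
  have "computable A (\<lambda>p. rec_nat (F (fst (prod_decode (fst p))) (snd p))
      (\<lambda>y r. Option.bind r (\<lambda>i. G (prod_encode (fst (prod_decode (fst p)), prod_encode (y, i))) (snd p)))
      (snd (prod_decode (fst p))))"
    by (intro computable_rec_nat computable_bind computable_compose2[OF cF] computable_compose2[OF cG]
      computable_intros)
  then show ?thesis
    unfolding case_prod_beta h_def[symmetric] H_def[symmetric]
    by (rule approximatesI) (rule hH, rule mH)
qed

lemma minimization_eq_Some_iff:
  "minimization f = Some k \<longleftrightarrow> f k = Some 0 \<and> (\<forall>m<k. f m \<noteq> None \<and> f m \<noteq> Some 0)"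
proof
  assume "minimization f = Some k"
  then obtain n where n: "f n = Some 0" "\<forall>m<n. f m \<noteq> None" and k: "k = (LEAST n. f n = Some 0)"
    by (auto simp: minimization_def split: if_splits)
  have "f k = Some 0" unfolding k by (rule LeastI, rule n)
  moreover have "k \<le> n" unfolding k by (rule Least_le, rule n)
  moreover have "m < k \<Longrightarrow> f m \<noteq> Some 0" for m unfolding k by (rule not_less_Least)
  ultimately show "f k = Some 0 \<and> (\<forall>m<k. f m \<noteq> None \<and> f m \<noteq> Some 0)" using n by auto
next
  assume k: "f k = Some 0 \<and> (\<forall>m<k. f m \<noteq> None \<and> f m \<noteq> Some 0)"
  then have "(LEAST n. f n = Some 0) = k"
    by (intro Least_equality) (auto simp: not_less[symmetric])
  with k show "minimization f = Some k" by (auto simp: minimization_def)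
qed

lemma computable_eq_option_nat:
  assumes "computable A f"
  shows "computable A (\<lambda>x. f x = Some (c::nat))" "computable A (\<lambda>x. f x = None)"
proof -
  have *: "(f x = Some c) = (case f x of None \<Rightarrow> False | Some y \<Rightarrow> y = c)"
    "(f x = None) = (case f x of None \<Rightarrow> True | Some y \<Rightarrow> False)" for x
    by (auto split: option.splits)
  show "computable A (\<lambda>x. f x = Some c)" "computable A (\<lambda>x. f x = None)"
    unfolding * by (intro computable_intros assms)+
qed

text \<open>
  At stage \<open>s\<close> the search looks for a \<open>k < s\<close> with value \<open>0\<close> such that all smaller arguments already
  have nonzero values. There is at most one such \<open>k\<close>, so the guess is never revised.
\<close>

lemma approximates_mn:
  assumes f: "approximates A f F"
  shows "\<exists>M. approximates A (\<lambda>n. minimization (\<lambda>k. f (prod_encode (n, k)))) M"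
proof -
  note cF = approximatesD(1)[OF f] and F = approximatesD(2)[OF f] and mF = approximatesD(3)[OF f]
  define P where "P n s k \<longleftrightarrow> F (prod_encode (n, k)) s = Some 0 \<and>
    (\<forall>m<k. F (prod_encode (n, m)) s \<noteq> None \<and> F (prod_encode (n, m)) s \<noteq> Some 0)" for n s k
  have uniq: "P n s k \<Longrightarrow> P n s l \<Longrightarrow> k = l" for n s k l
    by (metis P_def nat_neq_iff)
  define M where "M n s = rec_nat None (\<lambda>k r. if P n s k then Some k else r) s" for n s
  have M: "M n s = Some y \<longleftrightarrow> y < s \<and> P n s y" for n s y
  proof -
    have "rec_nat None (\<lambda>k r. if P n s k then Some k else r) t = Some y \<longleftrightarrow> y < t \<and> P n s y" for t
      by (induction t) (auto simp: less_Suc_eq dest: uniq)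
    then show ?thesis by (simp add: M_def)
  qed
  have mP: "P n t k" if P: "P n s k" and le: "s \<le> t" for n s t k
    unfolding P_def
  proof (intro conjI allI impI)
    show "F (prod_encode (n, k)) t = Some 0" using P mF[OF _ le] by (simp add: P_def)
    fix m assume "m < k"
    then obtain v where "F (prod_encode (n, m)) s = Some v" "v \<noteq> 0" using P by (auto simp: P_def)
    with mF[OF this(1) le]
    show "F (prod_encode (n, m)) t \<noteq> None" "F (prod_encode (n, m)) t \<noteq> Some 0" by simp_all
  qed
  have cP: "computable A (\<lambda>p. P (fst p) (fst (snd p)) (snd (snd p)))"
    unfolding P_def
    by (intro computable_ball_nat computable_conj computable_not computable_eq_option_nat
      computable_compose2[OF cF] computable_intros)
  have "computable A (\<lambda>p. M (fst p) (snd p))"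
    unfolding M_def by (intro computable_rec_nat computable_if computable_compose3[OF cP] computable_intros)
  moreover have "minimization (\<lambda>k. f (prod_encode (n, k))) = Some y \<longleftrightarrow> (\<exists>s. M n s = Some y)" for n y
  proof
    assume "minimization (\<lambda>k. f (prod_encode (n, k))) = Some y"
    then have y: "f (prod_encode (n, y)) = Some 0"
      "\<forall>m<y. f (prod_encode (n, m)) \<noteq> None \<and> f (prod_encode (n, m)) \<noteq> Some 0"
      by (auto simp: minimization_eq_Some_iff)
    then have "\<forall>m\<le>y. \<exists>s v. F (prod_encode (n, m)) s = Some v \<and> f (prod_encode (n, m)) = Some v"
      by (metis F le_less not_None_eq)
    then obtain s v where s: "\<And>m. m \<le> y \<Longrightarrow> F (prod_encode (n, m)) (s m) = Some (v m) \<and> f (prod_encode (n, m)) = Some (v m)"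
      by metis
    define t where "t = Max (insert (Suc y) (s ` {..y}))"
    have "s m \<le> t" if "m \<le> y" for m unfolding t_def using that by (intro Max_ge) auto
    then have "F (prod_encode (n, m)) t = f (prod_encode (n, m))" if "m \<le> y" for m
      using s[OF that] that by (auto intro: mF)
    then have "P n t y" using y by (auto simp: P_def)
    moreover have "Suc y \<le> t" unfolding t_def by (intro Max_ge) auto
    ultimately show "\<exists>s. M n s = Some y" by (intro exI[of _ t]) (simp add: M)
  next
    assume "\<exists>s. M n s = Some y"
    then obtain s where s: "P n s y" by (auto simp: M)
    then have "f (prod_encode (n, y)) = Some 0" by (auto simp: P_def F)
    moreover have "f (prod_encode (n, m)) \<noteq> None \<and> f (prod_encode (n, m)) \<noteq> Some 0" if m: "m < y" for m
    proof -
      obtain v where "F (prod_encode (n, m)) s = Some v" "v \<noteq> 0" using s m by (auto simp: P_def)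
      then have "f (prod_encode (n, m)) = Some v" by (auto simp: F)
      with \<open>v \<noteq> 0\<close> show ?thesis by simp
    qed
    ultimately show "minimization (\<lambda>k. f (prod_encode (n, k))) = Some y"
      by (auto simp: minimization_eq_Some_iff)
  qed
  moreover have "M n s = Some y \<Longrightarrow> s \<le> t \<Longrightarrow> M n t = Some y" for n s t y
    by (auto simp: M intro: mP)
  ultimately have "approximates A (\<lambda>n. minimization (\<lambda>k. f (prod_encode (n, k)))) M"
    by (rule approximatesI)
  then show ?thesis by (intro exI[of _ M])
qed

lemma partrec_approximable: "partrec A \<phi> \<Longrightarrow> \<exists>F. approximates A \<phi> F"
proof (induction rule: partrec.induct)
  case (pair f g)
  then show ?case using approximates_pair by blast
next
  case (comp f g)
  then show ?case using approximates_comp by blast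
next
  case (prec f g)
  then show ?case using approximates_prec by blast
next
  case (mn f)
  then show ?case using approximates_mn by blast
qed (rule exI, rule approximates_total, rule partrec.intros)+

text \<open>
  A decidable matrix behind one existential number quantifier, that is, a \<open>\<Sigma>\<^sub>1\<close> predicate relative
  to \<open>A\<close>.
\<close>

definition semidec :: "bool stream \<Rightarrow> ('a::coded \<Rightarrow> bool) \<Rightarrow> bool" where
  "semidec A P \<longleftrightarrow> (\<exists>R. computable A (\<lambda>p. R (fst p) (snd p)) \<and> (\<forall>x. P x \<longleftrightarrow> (\<exists>s::nat. R x s)))"

lemma semidecE:
  assumes "semidec A P"
  obtains R where "computable A (\<lambda>p. R (fst p) (snd p))" "\<And>x. P x \<longleftrightarrow> (\<exists>s::nat. R x s)"
  using assms unfolding semidec_def by blast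

lemma semidec_exI:
  assumes "computable A (\<lambda>p. R (fst p) (snd p))"
  shows "semidec A (\<lambda>x. \<exists>y::'b::coded. R x y)"
  unfolding semidec_def
proof (intro exI conjI allI)
  show "computable A (\<lambda>p. R (fst p) (decode (snd p)))"
    by (intro computable_compose2[OF assms] computable_compose[OF computable_decode] computable_intros)
  show "(\<exists>y. R x y) \<longleftrightarrow> (\<exists>s. R x (decode s))" for x
    by (metis decode_surj)
qed

lemma semidec_ex:
  fixes P :: "'a::coded \<Rightarrow> 'b::coded \<Rightarrow> bool"
  assumes "semidec A (\<lambda>p. P (fst p) (snd p))"
  shows "semidec A (\<lambda>x. \<exists>y. P x y)"
proof -
  obtain R where R: "computable A (\<lambda>p. R (fst p) (snd p))" "\<And>p. P (fst p) (snd p) \<longleftrightarrow> (\<exists>s::nat. R p s)"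
    using assms by (rule semidecE) blast
  have "semidec A (\<lambda>x. \<exists>q::'b \<times> nat. R (x, fst q) (snd q))"
    by (intro semidec_exI computable_compose2[OF R(1)] computable_intros)
  moreover have "(\<exists>y. P x y) \<longleftrightarrow> (\<exists>q::'b \<times> nat. R (x, fst q) (snd q))" for x
    using R(2)[of "(x, _)"] by auto
  ultimately show ?thesis by simp
qed

lemma semidec_compose:
  assumes "semidec A P" "computable A f"
  shows "semidec A (\<lambda>x. P (f x))"
proof -
  obtain R where R: "computable A (\<lambda>p. R (fst p) (snd p))" "\<And>x. P x \<longleftrightarrow> (\<exists>s::nat. R x s)"
    using assms(1) by (rule semidecE) blast
  have "semidec A (\<lambda>x. \<exists>s. R (f x) s)"
    by (intro semidec_exI computable_compose2[OF R(1)] computable_compose[OF assms(2)] computable_intros)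
  then show ?thesis by (simp add: R)
qed

lemma computable_imp_semidec:
  assumes "computable A P"
  shows "semidec A P"
proof -
  have "semidec A (\<lambda>x. \<exists>s::nat. P x)"
    by (intro semidec_exI computable_compose[OF assms] computable_intros)
  then show ?thesis by simp
qed

lemma semidec_conj:
  assumes "semidec A P" "semidec A Q"
  shows "semidec A (\<lambda>x. P x \<and> Q x)"
proof -
  obtain R where R: "computable A (\<lambda>p. R (fst p) (snd p))" "\<And>x. P x \<longleftrightarrow> (\<exists>s::nat. R x s)"
    using assms(1) by (rule semidecE) blast
  obtain S where S: "computable A (\<lambda>p. S (fst p) (snd p))" "\<And>x. Q x \<longleftrightarrow> (\<exists>s::nat. S x s)"
    using assms(2) by (rule semidecE) blast
  have "semidec A (\<lambda>x. \<exists>p::nat \<times> nat. R x (fst p) \<and> S x (snd p))"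
    by (intro semidec_exI computable_compose2[OF R(1)] computable_compose2[OF S(1)] computable_intros)
  then show ?thesis by (simp add: R S)
qed

lemma semidec_disj:
  assumes "semidec A P" "semidec A Q"
  shows "semidec A (\<lambda>x. P x \<or> Q x)"
proof -
  obtain R where R: "computable A (\<lambda>p. R (fst p) (snd p))" "\<And>x. P x \<longleftrightarrow> (\<exists>s::nat. R x s)"
    using assms(1) by (rule semidecE) blast
  obtain S where S: "computable A (\<lambda>p. S (fst p) (snd p))" "\<And>x. Q x \<longleftrightarrow> (\<exists>s::nat. S x s)"
    using assms(2) by (rule semidecE) blast
  have "semidec A (\<lambda>x. \<exists>s. R x s \<or> S x s)"
    by (intro semidec_exI computable_compose2[OF R(1)] computable_compose2[OF S(1)] computable_intros)
  then show ?thesis by (simp add: R S ex_disj_distrib)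
qed

text \<open>
  Finitely many witnesses have a common bound, so the bounded universal quantifier moves inside.
\<close>

lemma semidec_ball_list:
  fixes P :: "'b::coded \<Rightarrow> bool" and l :: "'a::coded \<Rightarrow> 'b list"
  assumes "semidec A P" "computable A l"
  shows "semidec A (\<lambda>x. \<forall>y\<in>set (l x). P y)"
proof -
  obtain R where R: "computable A (\<lambda>p. R (fst p) (snd p))" "\<And>x. P x \<longleftrightarrow> (\<exists>s::nat. R x s)"
    using assms(1) by (rule semidecE) blast
  have "semidec A (\<lambda>x. \<exists>t::nat. \<forall>y\<in>set (l x). \<exists>s<t. R y s)"
    by (intro semidec_exI computable_ball_list computable_bex_nat computable_compose2[OF R(1)]
      computable_compose[OF assms(2)] computable_intros)
  moreover have "(\<forall>y\<in>set m. P y) \<longleftrightarrow> (\<exists>t::nat. \<forall>y\<in>set m. \<exists>s<t. R y s)" for m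
  proof
    assume "\<forall>y\<in>set m. P y"
    then show "\<exists>t::nat. \<forall>y\<in>set m. \<exists>s<t. R y s"
    proof (induction m)
      case (Cons a m)
      then obtain t s where "\<forall>y\<in>set m. \<exists>s<t. R y s" "R a s" by (auto simp: R)
      then have "\<forall>y\<in>set (a # m). \<exists>s'<max t (Suc s). R y s'"
        by (auto simp: less_max_iff_disj)
      then show ?case by blast
    qed auto
  qed (auto simp: R)
  ultimately show ?thesis by simp
qed

lemma partrec_dom_semidec:
  assumes "partrec A \<phi>"
  shows "semidec A (\<lambda>n. \<phi> n \<noteq> None)"
proof -
  obtain F where "approximates A \<phi> F" using partrec_approximable[OF assms] ..
  note F = approximatesD(1,2)[OF this]
  have "semidec A (\<lambda>n. \<exists>s. F n s \<noteq> None)"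
    by (intro semidec_exI computable_not computable_eq_option_nat F)
  moreover have "\<phi> n \<noteq> None \<longleftrightarrow> (\<exists>s. F n s \<noteq> None)" for n
    using F(2)[of n] by (metis not_None_eq)
  ultimately show ?thesis by simp
qed

text \<open>
  Searching for the witness converges exactly where the predicate holds.
\<close>

lemma semidec_imp_partrec_dom:
  assumes "semidec A P"
  shows "\<exists>\<phi>. partrec A \<phi> \<and> (\<forall>n. \<phi> n \<noteq> None \<longleftrightarrow> P (decode n))"
proof -
  obtain R where R: "computable A (\<lambda>p. R (fst p) (snd p))" "\<And>x. P x \<longleftrightarrow> (\<exists>s::nat. R x s)"
    using assms by (rule semidecE) blast
  define g where "g n = (if R (decode (fst (prod_decode n))) (snd (prod_decode n)) then 0 else 1 :: nat)" for n
  have "computable A g" unfolding g_def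
    by (intro computable_if computable_compose2[OF R(1)] computable_compose[OF computable_decode] computable_intros)
  then have "partrec A (\<lambda>n. minimization (\<lambda>k. Some (g (prod_encode (n, k)))))"
    by (intro partrec.mn[of A "\<lambda>n. Some (g n)"]) (simp add: computable_nat_iff computable_nat_def)
  moreover have "minimization (\<lambda>k. Some (g (prod_encode (n, k)))) \<noteq> None \<longleftrightarrow> P (decode n)" for n
    by (auto simp: minimization_def g_def R)
  ultimately show ?thesis by blast
qed

lemma ce_strings_iff_semidec: "ce_strings A U \<longleftrightarrow> semidec A (\<lambda>\<sigma>. \<sigma> \<in> U)"
proof
  assume "ce_strings A U"
  then obtain \<phi> where "partrec A \<phi>" and U: "U = {\<sigma>. \<phi> (string_code \<sigma>) \<noteq> None}"
    unfolding ce_strings_def by blast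
  from semidec_compose[OF partrec_dom_semidec[OF this(1)], of string_code]
  show "semidec A (\<lambda>\<sigma>. \<sigma> \<in> U)" by (simp add: U computable_intros del: not_None_eq)
next
  assume "semidec A (\<lambda>\<sigma>. \<sigma> \<in> U)"
  then obtain \<phi> where \<phi>: "partrec A \<phi>" "\<And>n. \<phi> n \<noteq> None \<longleftrightarrow> decode n \<in> U"
    using semidec_imp_partrec_dom by blast
  from \<phi>(2)[of "string_code \<sigma>" for \<sigma>] have "U = {\<sigma>. \<phi> (string_code \<sigma>) \<noteq> None}" by simp
  with \<phi>(1) show "ce_strings A U" unfolding ce_strings_def by blast
qed

lemma uniformly_ce_strings_iff_semidec:
  "uniformly_ce_strings A W \<longleftrightarrow> semidec A (\<lambda>p. snd p \<in> W (fst p))"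
proof
  assume "uniformly_ce_strings A W"
  then obtain \<phi> where "partrec A \<phi>" and W: "\<And>n. W n = {\<sigma>. \<phi> (prod_encode (n, string_code \<sigma>)) \<noteq> None}"
    unfolding uniformly_ce_strings_def by blast
  from semidec_compose[OF partrec_dom_semidec[OF this(1)], of "\<lambda>p. prod_encode (fst p, string_code (snd p))"]
  show "semidec A (\<lambda>p. snd p \<in> W (fst p))" by (simp add: W computable_intros del: not_None_eq)
next
  assume "semidec A (\<lambda>p. snd p \<in> W (fst p))"
  then obtain \<phi> where \<phi>: "partrec A \<phi>"
    "\<And>n. \<phi> n \<noteq> None \<longleftrightarrow> (\<lambda>p. snd p \<in> W (fst p)) (decode n)"
    using semidec_imp_partrec_dom by blast
  from \<phi>(2)[of "prod_encode (n, string_code \<sigma>)" for n \<sigma>]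
  have "W n = {\<sigma>. \<phi> (prod_encode (n, string_code \<sigma>)) \<noteq> None}" for n
    by (simp add: decode_prod_def)
  with \<phi>(1) show "uniformly_ce_strings A W" unfolding uniformly_ce_strings_def by blast
qed

lemma computable_real_iff:
  "computable_real A r \<longleftrightarrow> (\<exists>a. computable A a \<and> (\<forall>n. \<bar>of_rat (a n) - r\<bar> \<le> (1 / 2) ^ n))"
proof
  assume "computable_real A r"
  then obtain g where g: "computable A g" "\<forall>n. \<bar>of_rat (nat_to_rat_surj (g n)) - r\<bar> \<le> (1 / 2) ^ n"
    by (auto simp: computable_real_def computable_nat_iff)
  have "computable A (\<lambda>n. decode (g n) :: rat)"
    by (rule computable_compose[OF computable_decode g(1)])
  with g(2) show "\<exists>a. computable A a \<and> (\<forall>n. \<bar>of_rat (a n) - r\<bar> \<le> (1 / 2) ^ n)"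
    by (intro exI[of _ "\<lambda>n. decode (g n)"]) (simp add: decode_rat_def)
next
  assume "\<exists>a. computable A a \<and> (\<forall>n. \<bar>of_rat (a n) - r\<bar> \<le> (1 / 2) ^ n)"
  then obtain a :: "nat \<Rightarrow> rat" where a: "computable A a" "\<forall>n. \<bar>of_rat (a n) - r\<bar> \<le> (1 / 2) ^ n" by blast
  obtain g where g: "computable_nat A g" "\<And>n. a n = decode (g n)"
    using a(1) by (rule computableE) simp
  with a(2) show "computable_real A r"
    unfolding computable_real_def decode_rat_def by auto
qed

lemma computable_string_realD:
  assumes "computable_string_real A d"
  shows "\<exists>a. computable A (\<lambda>p. a (fst p) (snd p)) \<and> (\<forall>\<sigma> n. \<bar>of_rat (a \<sigma> n) - d \<sigma>\<bar> \<le> (1 / 2) ^ n)"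
proof -
  obtain g where g: "computable A g"
    "\<forall>\<sigma> n. \<bar>of_rat (nat_to_rat_surj (g (prod_encode (string_code \<sigma>, n)))) - d \<sigma>\<bar> \<le> (1 / 2) ^ n"
    using assms by (auto simp: computable_string_real_def computable_nat_iff)
  have "computable A (\<lambda>p. decode (g (prod_encode (string_code (fst p), snd p))) :: rat)"
    by (intro computable_compose[OF computable_decode] computable_compose[OF g(1)] computable_intros)
  with g(2) show ?thesis
    by (intro exI[of _ "\<lambda>\<sigma> n. decode (g (prod_encode (string_code \<sigma>, n)))"]) (simp add: decode_rat_def)
qed

lemma exactly_computable_iff:
  "exactly_computable d \<longleftrightarrow> (\<exists>f. computable no_oracle f \<and> d = (\<lambda>\<sigma>. of_rat (f \<sigma>)))"
proof
  assume "exactly_computable d"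
  then obtain f g where g: "computable no_oracle g" and f: "\<And>\<sigma>. f \<sigma> = nat_to_rat_surj (g (string_code \<sigma>))"
    and d: "\<And>\<sigma>. d \<sigma> = of_rat (f \<sigma>)"
    by (auto simp: exactly_computable_def computable_string_rat_def computable_nat_iff)
  have "computable no_oracle (\<lambda>\<sigma>. decode (g (string_code \<sigma>)) :: rat)"
    by (intro computable_compose[OF computable_decode] computable_compose[OF g] computable_intros)
  then have "computable no_oracle f" by (simp add: decode_rat_def flip: f)
  with d show "\<exists>f. computable no_oracle f \<and> d = (\<lambda>\<sigma>. of_rat (f \<sigma>))" by blast
next
  assume "\<exists>f. computable no_oracle f \<and> d = (\<lambda>\<sigma>. of_rat (f \<sigma>))"
  then obtain f where f: "computable no_oracle f" and d: "d = (\<lambda>\<sigma>. of_rat (f \<sigma>))" by blast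
  obtain g where g: "computable_nat no_oracle g" "\<And>n. f (decode n) = decode (g n)"
    using f by (rule computableE) blast
  from g(2)[of "string_code \<sigma>" for \<sigma>] have "f \<sigma> = nat_to_rat_surj (g (string_code \<sigma>))" for \<sigma>
    by (simp add: decode_rat_def)
  with g(1) d show "exactly_computable d"
    unfolding exactly_computable_def computable_string_rat_def by auto
qed

lemma exactly_computable_imp_computable_string_real:
  assumes "exactly_computable d"
  shows "computable_string_real no_oracle d"
proof -
  obtain f where f: "computable no_oracle f" and d: "d = (\<lambda>\<sigma>. of_rat (f \<sigma>))"
    using assms exactly_computable_iff by blast
  have "computable no_oracle (\<lambda>p::bool list \<times> nat. f (fst p))"
    by (intro computable_compose[OF f] computable_intros)
  then obtain g where g: "computable_nat no_oracle g"
    "\<forall>n. (\<lambda>p::bool list \<times> nat. f (fst p)) (decode n) = decode (g n)"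
    unfolding computable_def by blast
  from g(2)[rule_format, of "prod_encode (string_code \<sigma>, n)" for \<sigma> n]
  have "f \<sigma> = nat_to_rat_surj (g (prod_encode (string_code \<sigma>, n)))" for \<sigma> n
    by (simp add: decode_prod_def decode_rat_def)
  with g(1) show ?thesis unfolding computable_string_real_def d by (metis abs_0 diff_self zero_le_divide_1_iff
      zero_le_numeral zero_le_power)
qed

subsection \<open>There are only countably many partial recursive functions\<close>

text \<open>
  The closure rules of \<^const>\<open>partrec\<close> as syntax: a countable type of programs, which makes it
  possible to list all exactly computable martingales in one sequence.
\<close>

datatype prog = Zero | Succ | Left | Right | Query | Pairing prog prog | Comp prog prog
  | Prec prog prog | Mn prog

instance prog :: countable by countable_datatype

primrec run :: "bool stream \<Rightarrow> prog \<Rightarrow> nat \<Rightarrow> nat option" where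
  "run A Zero = (\<lambda>n. Some 0)"
| "run A Succ = (\<lambda>n. Some (Suc n))"
| "run A Left = (\<lambda>n. Some (fst (prod_decode n)))"
| "run A Right = (\<lambda>n. Some (snd (prod_decode n)))"
| "run A Query = (\<lambda>n. Some (of_bool (A !! n)))"
| "run A (Pairing p q) =
    (\<lambda>n. Option.bind (run A p n) (\<lambda>a. Option.bind (run A q n) (\<lambda>b. Some (prod_encode (a, b)))))"
| "run A (Comp p q) = (\<lambda>n. Option.bind (run A q n) (run A p))"
| "run A (Prec p q) = (\<lambda>n. case prod_decode n of (a, k) \<Rightarrow>
      rec_nat (run A p a)
        (\<lambda>y r. Option.bind r (\<lambda>i. run A q (prod_encode (a, prod_encode (y, i))))) k)"
| "run A (Mn p) = (\<lambda>n. minimization (\<lambda>k. run A p (prod_encode (n, k))))"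

lemma partrec_run: "partrec A \<phi> \<Longrightarrow> \<phi> \<in> range (run A)"
proof (induction rule: partrec.induct)
  case (pair f g)
  then obtain p q where "f = run A p" "g = run A q" by auto
  then show ?case by (intro range_eqI[of _ _ "Pairing p q"]) simp
next
  case (comp f g)
  then obtain p q where "f = run A p" "g = run A q" by auto
  then show ?case by (intro range_eqI[of _ _ "Comp p q"]) simp
next
  case (prec f g)
  then obtain p q where "f = run A p" "g = run A q" by auto
  then show ?case by (intro range_eqI[of _ _ "Prec p q"]) simp
next
  case (mn f)
  then obtain p where "f = run A p" by auto
  then show ?case by (intro range_eqI[of _ _ "Mn p"]) simp
qed (rule range_eqI[of _ _ Zero] range_eqI[of _ _ Succ] range_eqI[of _ _ Left]
    range_eqI[of _ _ Right] range_eqI[of _ _ Query], simp; fail)+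

lemma countable_exactly_computable: "countable {d. exactly_computable d}"
proof -
  have "{d. exactly_computable d}
    \<subseteq> (\<lambda>p \<sigma>. of_rat (nat_to_rat_surj (the (run no_oracle p (string_code \<sigma>))))) ` UNIV"
  proof
    fix d assume "d \<in> {d. exactly_computable d}"
    then obtain g where g: "computable_nat no_oracle g"
      and d: "d = (\<lambda>\<sigma>. of_rat (nat_to_rat_surj (g (string_code \<sigma>))))"
      by (auto simp: exactly_computable_def computable_string_rat_def fun_eq_iff)
    obtain p where "run no_oracle p = (\<lambda>n. Some (g n))"
      using partrec_run[of no_oracle "\<lambda>n. Some (g n)"] g by (auto simp: computable_nat_def)
    then show "d \<in> (\<lambda>p \<sigma>. of_rat (nat_to_rat_surj (the (run no_oracle p (string_code \<sigma>))))) ` UNIV"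
      by (intro image_eqI[of _ _ p]) (auto simp: d)
  qed
  then show ?thesis by (rule countable_subset) simp
qed

section \<open>The uniform measure on Cantor space\<close>

abbreviation "\<mu> \<equiv> measure cantor_measure"

definition prepend :: "bool list \<Rightarrow> bool stream set \<Rightarrow> bool stream set" where
  "prepend \<sigma> S = {X. stake (length \<sigma>) X = \<sigma> \<and> sdrop (length \<sigma>) X \<in> S}"

lemma prob_space_coin: "prob_space (uniform_count_measure (UNIV :: bool set))"
  by (rule prob_space_uniform_count_measure) auto

interpretation cantor: prob_space cantor_measure
  unfolding cantor_measure_def by (rule prob_space.prob_space_stream_space[OF prob_space_coin])

lemma space_cantor [simp]: "space cantor_measure = UNIV"
  by (simp add: cantor_measure_def space_stream_space space_uniform_count_measure)

lemma sets_cantor: "sets cantor_measure = sets (stream_space (count_space UNIV))"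
  unfolding cantor_measure_def by (rule sets_stream_space_cong) (simp add: sets_uniform_count_measure)

lemma sets_prepend [measurable]:
  assumes "S \<in> sets cantor_measure"
  shows "prepend \<sigma> S \<in> sets cantor_measure"
proof -
  have [measurable]: "S \<in> sets (stream_space (count_space UNIV))"
    using assms by (simp add: sets_cantor)
  have "prepend \<sigma> S = {X \<in> space (stream_space (count_space UNIV)).
      stake (length \<sigma>) X = \<sigma> \<and> sdrop (length \<sigma>) X \<in> S}"
    by (auto simp: prepend_def space_stream_space)
  also have "\<dots> \<in> sets (stream_space (count_space UNIV))" by measurable
  finally show ?thesis by (simp add: sets_cantor)
qed

lemma open_of_conv_prepend: "open_of U = (\<Union>\<sigma>\<in>U. prepend \<sigma> UNIV)"
  by (auto simp: open_of_def prepend_def) (metis length_stake)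

lemma sets_UNIV_cantor [measurable]: "UNIV \<in> sets cantor_measure"
  using sets.top[of cantor_measure] by simp

lemma sets_open_of [measurable, simp]: "open_of U \<in> sets cantor_measure"
  unfolding open_of_conv_prepend by (intro sets.countable_UN' sets_prepend sets_UNIV_cantor) auto

text \<open>
  Conditioning on the first coin toss.
\<close>

lemma measure_halves:
  assumes "S \<in> sets cantor_measure"
  shows "\<mu> S = (\<mu> {X. False ## X \<in> S} + \<mu> {X. True ## X \<in> S}) / 2"
proof -
  let ?C = "uniform_count_measure (UNIV :: bool set)"
  interpret coin: prob_space ?C by (rule prob_space_coin)
  have "emeasure cantor_measure S = (\<integral>\<^sup>+t. emeasure cantor_measure {X. t ## X \<in> S} \<partial>?C)"
    using coin.emeasure_stream_space[of S] assms
    by (simp add: cantor_measure_def space_stream_space space_uniform_count_measure)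
  also have "\<dots> = (\<Sum>t\<in>UNIV. emeasure cantor_measure {X. t ## X \<in> S} * ennreal (1 / 2))"
    unfolding uniform_count_measure_def
    by (subst nn_integral_point_measure_finite) (auto simp: mult.commute ennreal_divide_numeral)
  also have "\<dots> = ennreal ((\<mu> {X. False ## X \<in> S} + \<mu> {X. True ## X \<in> S}) / 2)"
  proof -
    have "ennreal ((a + b) / 2) = ennreal a * ennreal (1 / 2) + ennreal b * ennreal (1 / 2)"
      if "0 \<le> a" "0 \<le> b" for a b
    proof -
      have "(a + b) / 2 = a * (1 / 2) + b * (1 / 2)" by simp
      then show ?thesis
        using that by (simp only: ennreal_plus ennreal_mult mult_nonneg_nonneg zero_le_divide_1_iff zero_le_numeral)
    qed
    then show ?thesis by (simp add: UNIV_bool cantor.emeasure_eq_measure)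
  qed
  finally show ?thesis by (simp add: cantor.emeasure_eq_measure)
qed

lemma measure_prepend:
  assumes "S \<in> sets cantor_measure"
  shows "\<mu> (prepend \<sigma> S) = (1 / 2) ^ length \<sigma> * \<mu> S"
proof (induction \<sigma>)
  case Nil
  then show ?case by (simp add: prepend_def)
next
  case (Cons b \<sigma>)
  have "{X. b ## X \<in> prepend (b # \<sigma>) S} = prepend \<sigma> S"
    "{X. (\<not> b) ## X \<in> prepend (b # \<sigma>) S} = {}"
    by (auto simp: prepend_def)
  then show ?case
    using measure_halves[OF sets_prepend[OF assms, of "b # \<sigma>"]] Cons by (cases b) simp_all
qed

lemma measure_cylinder: "\<mu> (prepend \<sigma> UNIV) = (1 / 2) ^ length \<sigma>"
  using measure_prepend[OF sets_UNIV_cantor, of \<sigma>] cantor.prob_space by simp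

lemma open_of_mono: "U \<subseteq> V \<Longrightarrow> open_of U \<subseteq> open_of V"
  by (auto simp: open_of_def)

lemma disjoint_prepend:
  assumes "prefix_free U" "\<sigma> \<in> U" "\<tau> \<in> U" "\<sigma> \<noteq> \<tau>"
  shows "prepend \<sigma> S \<inter> prepend \<tau> T = {}"
proof -
  have pre: "prefix (stake m X) (stake n X)" if "m \<le> n" for m n and X :: "bool stream"
    using take_is_prefix[of m "stake n X"] that by (simp add: take_stake min_absorb1)
  then have "prefix \<sigma> \<tau> \<or> prefix \<tau> \<sigma>"
    if "stake (length \<sigma>) X = \<sigma>" "stake (length \<tau>) X = \<tau>" for X
    using that(1) that(2) le_cases[of "length \<sigma>" "length \<tau>"] pre[of "length \<sigma>" "length \<tau>" X]
      pre[of "length \<tau>" "length \<sigma>" X] by argo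
  then have "prefix \<sigma> \<tau> \<or> prefix \<tau> \<sigma>" if "prepend \<sigma> S \<inter> prepend \<tau> T \<noteq> {}"
    using that unfolding prepend_def by blast
  then show ?thesis using assms by (auto simp: prefix_free_def)
qed

text \<open>
  \<open>[UV]\<close> is the union of the copies of \<open>[V]\<close> below the strings of \<open>U\<close>. These copies are disjoint
  since \<open>U\<close> is prefix-free, and the copy below \<open>u\<close> is \<open>[V]\<close> scaled by the measure of the cone of
  \<open>u\<close>.
\<close>

lemma measure_open_of_concat:
  assumes "prefix_free U"
  shows "\<mu> (open_of {u @ v | u v. u \<in> U \<and> v \<in> V}) = \<mu> (open_of U) * \<mu> (open_of V)"
proof -
  have eq: "open_of {u @ v | u v. u \<in> U \<and> v \<in> V} = (\<Union>u\<in>U. prepend u (open_of V))" (is "?L = ?R")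
  proof
    show "?L \<subseteq> ?R"
    proof
      fix X assume "X \<in> ?L"
      then obtain n u v where n: "stake n X = u @ v" "u \<in> U" "v \<in> V" by (auto simp: open_of_def)
      then have nl: "n = length u + length v" by (metis length_append length_stake)
      then have "stake (length u) X @ stake (length v) (sdrop (length u) X) = u @ v"
        using n by (simp add: stake_add)
      from append_eq_append_conv[OF disjI1, THEN iffD1, OF length_stake this]
      have "stake (length u) X = u" "stake (length v) (sdrop (length u) X) = v" by blast+
      with n(3) have "X \<in> prepend u (open_of V)"
        unfolding prepend_def open_of_def by (auto intro!: exI[of _ "length v"])
      with n(2) show "X \<in> ?R" by (rule UN_I)
    qed
    show "?R \<subseteq> ?L"
    proof
      fix X assume "X \<in> ?R"
      then obtain u n where "u \<in> U" "stake (length u) X = u" "stake n (sdrop (length u) X) \<in> V"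
        by (auto simp: prepend_def open_of_def)
      moreover have "stake (length u + n) X = stake (length u) X @ stake n (sdrop (length u) X)"
        by (simp add: stake_add)
      ultimately have "stake (length u + n) X \<in> {u @ v | u v. u \<in> U \<and> v \<in> V}" by auto
      then show "X \<in> ?L" unfolding open_of_def by blast
    qed
  qed
  have disj: "disjoint_family_on (\<lambda>u. prepend u S) U" for S
    using disjoint_prepend[OF assms] by (auto simp: disjoint_family_on_def)
  have pow: "ennreal ((1 / 2) ^ n * x) = ennreal x * ennreal ((1 / 2) ^ n)" if "0 \<le> x" for n x
    using that by (simp add: ennreal_mult mult.commute)
  have "emeasure cantor_measure (\<Union>u\<in>U. prepend u S)
      = emeasure cantor_measure S * (\<integral>\<^sup>+u. ennreal ((1 / 2) ^ length u) \<partial>count_space U)"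
    if "S \<in> sets cantor_measure" for S
    by (subst emeasure_UN_countable[OF _ _ disj])
      (use that in \<open>auto simp: cantor.emeasure_eq_measure measure_prepend pow nn_integral_cmult intro: sets_prepend\<close>)
  from this[of "open_of V"] this[of UNIV]
  have "emeasure cantor_measure (open_of {u @ v | u v. u \<in> U \<and> v \<in> V})
      = emeasure cantor_measure (open_of U) * emeasure cantor_measure (open_of V)"
    unfolding eq open_of_conv_prepend[of U] using cantor.emeasure_space_1
    by (simp add: mult.commute)
  then show ?thesis by (simp add: cantor.emeasure_eq_measure ennreal_mult'[symmetric])
qed

lemma has_sum_prefix_free:
  assumes "prefix_free U"
  shows "((\<lambda>\<sigma>. (1 / 2) ^ length \<sigma>) has_sum \<mu> (open_of U)) U"
proof -
  \<comment> \<open>Countable additivity is applied to cones indexed by their string codes.\<close>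
  define B where "B j = (if j \<in> string_code ` U then prepend (decode j) UNIV else {})" for j
  have eq: "(\<Union>j. B j) = open_of U"
    by (auto simp: B_def open_of_conv_prepend split: if_splits)
  have "disjoint_family B"
    unfolding disjoint_family_on_def
  proof (intro ballI impI)
    fix i j :: nat assume "i \<noteq> j"
    then show "B i \<inter> B j = {}"
      using disjoint_prepend[OF assms, of _ _ UNIV UNIV] unfolding B_def by auto blast
  qed
  moreover have "range B \<subseteq> sets cantor_measure"
    by (auto simp: B_def intro: sets_prepend)
  ultimately have "(\<lambda>j. \<mu> (B j)) sums \<mu> (open_of U)"
    using cantor.finite_measure_UNION[of B] eq by simp
  then have "((\<lambda>j. \<mu> (B j)) has_sum \<mu> (open_of U)) UNIV"
    by (intro sums_nonneg_imp_has_sum) auto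
  moreover have "((\<lambda>j. \<mu> (B j)) has_sum \<mu> (open_of U)) UNIV
      \<longleftrightarrow> ((\<lambda>j. \<mu> (B j)) has_sum \<mu> (open_of U)) (string_code ` U)"
    by (rule has_sum_cong_neutral) (auto simp: B_def)
  ultimately have "((\<lambda>j. \<mu> (B j)) has_sum \<mu> (open_of U)) (string_code ` U)" by blast
  then have "((\<lambda>j. \<mu> (B j)) \<circ> string_code has_sum \<mu> (open_of U)) U"
    by (subst (asm) has_sum_reindex) (auto simp: inj_on_def)
  then show ?thesis
    by (rule has_sum_cong[THEN iffD1, rotated]) (auto simp: B_def measure_cylinder)
qed

subsection \<open>Initial intervals\<close>

text \<open>
  The right endpoint of the dyadic interval of reals in \<open>[0,1]\<close> with a binary expansion that starts
  with the given string.
\<close>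

primrec right :: "bool list \<Rightarrow> rat" where
  "right [] = 1"
| "right (b # \<sigma>) = (of_nat (of_bool b) + right \<sigma>) / 2"

definition below :: "real \<Rightarrow> bool list set" where
  "below z = {\<sigma>. of_rat (right \<sigma>) < z}"

lemma right_pos: "right \<sigma> > 0"
  by (induction \<sigma>) auto

lemma Stream_in_open_below: "b ## X \<in> open_of (below z) \<longleftrightarrow> X \<in> open_of (below (2 * z - of_bool b))"
proof -
  have step: "b # \<sigma> \<in> below z \<longleftrightarrow> \<sigma> \<in> below (2 * z - of_bool b)" for \<sigma>
    by (auto simp: below_def of_rat_add of_rat_divide field_simps)
  have nil: "[] \<in> below z \<Longrightarrow> [] \<in> below (2 * z - of_bool b)"
    by (auto simp: below_def)
  show ?thesis
  proof
    assume "b ## X \<in> open_of (below z)"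
    then obtain n where n: "stake n (b ## X) \<in> below z" by (auto simp: open_of_def)
    show "X \<in> open_of (below (2 * z - of_bool b))"
    proof (cases n)
      case 0
      then have "stake 0 X \<in> below (2 * z - of_bool b)" using n nil by simp
      then show ?thesis unfolding open_of_def by blast
    next
      case (Suc m)
      then have "stake m X \<in> below (2 * z - of_bool b)" using n step by simp
      then show ?thesis unfolding open_of_def by blast
    qed
  next
    assume "X \<in> open_of (below (2 * z - of_bool b))"
    then obtain n where "stake n X \<in> below (2 * z - of_bool b)" by (auto simp: open_of_def)
    then have "stake (Suc n) (b ## X) \<in> below z" using step by simp
    then show "b ## X \<in> open_of (below z)" unfolding open_of_def by blast
  qed
qed

text \<open>
  By self-similarity, the measure \<open>F z\<close> of \<open>[below z]\<close> satisfies
  \<open>F z = (F (2 z) + F (2 z - 1)) / 2\<close>. On \<open>[0,1]\<close> one of the two terms on the right is always \<open>0\<close> or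
  \<open>1\<close> as it should be, so that each use of the equation halves the possible distance between
  \<open>F z\<close> and \<open>z\<close>.
\<close>

lemma measure_open_below:
  assumes "0 \<le> z" "z \<le> 1"
  shows "\<mu> (open_of (below z)) = z"
proof -
  define F where "F z = \<mu> (open_of (below z))" for z
  have F: "F z = (F (2 * z) + F (2 * z - 1)) / 2" for z
    unfolding F_def by (subst measure_halves) (simp_all add: Stream_in_open_below)
  have F0: "F z = 0" if "z \<le> 0" for z
  proof -
    have "z \<le> of_rat (right \<sigma>)" for \<sigma>
      by (rule order.trans[OF that]) (simp add: right_pos less_imp_le)
    then have "below z = {}" by (simp add: below_def not_less)
    then show ?thesis by (simp add: F_def open_of_def)
  qed
  have F2: "F z = 1" if "z > 1" for z
  proof -
    have "[] \<in> below z" using that by (simp add: below_def)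
    then have "stake 0 X \<in> below z" for X by simp
    then have "open_of (below z) = UNIV" unfolding open_of_def by blast
    then show ?thesis using cantor.prob_space by (simp add: F_def)
  qed
  have F1: "F z = 1" if "z \<ge> 1" for z
  proof (cases "z = 1")
    case True
    have "F 1 = (1 + F 1) / 2" using F[of 1] F2[of 2] by simp
    then show ?thesis using True by simp
  qed (use that F2 in auto)
  have bound: "\<bar>F z - z\<bar> \<le> (1 / 2) ^ n" if "0 \<le> z" "z \<le> 1" for n z
    using that
  proof (induction n arbitrary: z)
    case 0
    have "0 \<le> F z" "F z \<le> 1" by (auto simp: F_def)
    with 0 show ?case by auto
  next
    case (Suc n)
    show ?case
    proof (cases "2 * z \<le> 1")
      case True
      then have "F z - z = (F (2 * z) - 2 * z) / 2" using F[of z] F0[of "2 * z - 1"] by simp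
      then have "\<bar>F z - z\<bar> = \<bar>F (2 * z) - 2 * z\<bar> / 2" by (simp only: abs_divide abs_numeral)
      also have "\<dots> \<le> (1 / 2) ^ n / 2" using Suc.IH Suc.prems True by (intro divide_right_mono) auto
      finally show ?thesis by simp
    next
      case False
      then have "F z - z = (F (2 * z - 1) - (2 * z - 1)) / 2"
        using F[of z] F1[of "2 * z"] by (simp add: field_simps)
      then have "\<bar>F z - z\<bar> = \<bar>F (2 * z - 1) - (2 * z - 1)\<bar> / 2" by (simp only: abs_divide abs_numeral)
      also have "\<dots> \<le> (1 / 2) ^ n / 2" using Suc.IH Suc.prems False by (intro divide_right_mono) auto
      finally show ?thesis by simp
    qed
  qed
  have "\<bar>F z - z\<bar> \<le> 0"
    by (rule tendsto_lowerbound[of "\<lambda>n. (1 / 2) ^ n :: real" 0 sequentially])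
      (auto intro!: LIMSEQ_realpow_zero bound[OF assms] always_eventually)
  then show ?thesis by (simp add: F_def)
qed

lemma computable_right: "computable A right"
proof -
  have "right \<sigma> = foldl (\<lambda>r b. (of_nat (of_bool b) + r) / 2) 1 (rev \<sigma>)" for \<sigma>
    by (induction \<sigma>) auto
  then have *: "right = (\<lambda>\<sigma>. foldl (\<lambda>r b. (of_nat (of_bool b) + r) / 2) 1 (rev \<sigma>))" by (rule ext)
  show ?thesis by (subst *) (intro computable_intros)
qed

section \<open>Prefix-free generators\<close>

text \<open>
  Call \<open>\<sigma>\<close> ready if some prefix of \<open>\<sigma>\<close> is enumerated into \<open>W n\<close> within \<open>length \<sigma>\<close> stages. This is
  decidable and inherited by extensions, and every string of \<open>W n\<close> becomes ready when it is
  extended far enough. The minimal ready strings therefore form a decidable prefix-free set with the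
  same open set.
\<close>

lemma prefix_free_generators:
  fixes W :: "nat \<Rightarrow> bool list set"
  assumes "semidec A (\<lambda>p. snd p \<in> W (fst p))"
  shows "\<exists>W'. semidec A (\<lambda>p. snd p \<in> W' (fst p)) \<and>
    (\<forall>n. prefix_free (W' n) \<and> open_of (W' n) = open_of (W n))"
proof -
  obtain R where R: "computable A (\<lambda>p. R (fst p) (snd p))"
    "\<And>p. snd p \<in> W (fst p) \<longleftrightarrow> (\<exists>s::nat. R p s)"
    using assms by (rule semidecE) blast
  define Q where "Q p \<longleftrightarrow> (\<exists>i<Suc (length (snd p)). \<exists>s<Suc (length (snd p)). R (fst p, take i (snd p)) s)"
    for p :: "nat \<times> bool list"
  define W' where "W' n = {\<sigma>. Q (n, \<sigma>) \<and> (\<forall>i<length \<sigma>. \<not> Q (n, take i \<sigma>))}" for n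
  have cQ: "computable A Q"
    unfolding Q_def by (intro computable_bex_nat computable_compose2[OF R(1)] computable_intros)
  have "computable A (\<lambda>p. snd p \<in> W' (fst p))"
    unfolding W'_def mem_Collect_eq
    by (intro computable_compose[OF cQ] computable_conj computable_ball_nat computable_not computable_intros)
  then have "semidec A (\<lambda>p. snd p \<in> W' (fst p))" by (rule computable_imp_semidec)
  moreover have "prefix_free (W' n)" for n
    unfolding prefix_free_def
  proof (intro ballI impI)
    fix \<sigma> \<tau> assume *: "\<sigma> \<in> W' n" "\<tau> \<in> W' n" "prefix \<sigma> \<tau>"
    then have "\<sigma> = take (length \<sigma>) \<tau>" "length \<sigma> \<le> length \<tau>" by (auto simp: prefix_def)
    with * show "\<sigma> = \<tau>" by (cases "length \<sigma> < length \<tau>") (auto simp: W'_def)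
  qed
  moreover have "open_of (W' n) = open_of (W n)" for n
  proof
    show "open_of (W' n) \<subseteq> open_of (W n)"
    proof
      fix X assume "X \<in> open_of (W' n)"
      then obtain k where "Q (n, stake k X)" by (auto simp: open_of_def W'_def)
      then obtain i s where "i \<le> k" "R (n, take i (stake k X)) s" by (auto simp: Q_def less_Suc_eq_le)
      then have "stake i X \<in> W n" using R(2)[of "(n, stake i X)"] by (auto simp: take_stake min_absorb1)
      then show "X \<in> open_of (W n)" by (auto simp: open_of_def)
    qed
    show "open_of (W n) \<subseteq> open_of (W' n)"
    proof
      fix X assume "X \<in> open_of (W n)"
      then obtain i s where s: "R (n, stake i X) s"
        using R(2)[of "(n, _)"] by (auto simp: open_of_def)
      have "Q (n, stake (max i s) X)"
        unfolding Q_def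
        by (rule exI[of _ i], rule conjI[rotated], rule exI[of _ s])
          (use s in \<open>auto simp: take_stake less_Suc_eq_le min_absorb1\<close>)
      then have ex: "\<exists>k. Q (n, stake k X)" by blast
      define k where "k = (LEAST k. Q (n, stake k X))"
      have "Q (n, stake k X)" unfolding k_def by (rule LeastI_ex[OF ex])
      moreover have "\<not> Q (n, take i (stake k X))" if "i < k" for i
        using not_less_Least[of i "\<lambda>k. Q (n, stake k X)"] that
        by (simp add: k_def take_stake min_absorb1)
      ultimately have "stake k X \<in> W' n" by (simp add: W'_def)
      then show "X \<in> open_of (W' n)" unfolding open_of_def by blast
    qed
  qed
  ultimately show ?thesis by blast
qed

lemma Schnorr_openI:
  assumes "semidec A (\<lambda>\<sigma>. \<sigma> \<in> U)" "computable_real A (\<mu> (open_of U))"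
  shows "Schnorr_open A (open_of U)"
proof -
  have "semidec A (\<lambda>p::nat \<times> bool list. snd p \<in> (\<lambda>_. U) (fst p))"
    using semidec_compose[OF assms(1), of snd] by (simp add: computable_intros)
  from prefix_free_generators[OF this] obtain W' :: "nat \<Rightarrow> bool list set"
    where W': "semidec A (\<lambda>p. snd p \<in> W' (fst p))" "\<forall>n. prefix_free (W' n) \<and> open_of (W' n) = open_of U"
    by (elim exE conjE) (rule that)
  have "semidec A (\<lambda>\<sigma>. \<sigma> \<in> W' 0)"
    using semidec_compose[OF W'(1), of "\<lambda>\<sigma>. (0, \<sigma>)"] by (simp add: computable_intros)
  then have "ce_open A (open_of U)"
    using W' unfolding ce_open_def ce_strings_iff_semidec by metis
  with assms(2) show ?thesis by (simp add: Schnorr_open_def)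
qed

section \<open>Schnorr open sets from weighted listings\<close>

primrec strings :: "nat \<Rightarrow> bool list list" where
  "strings 0 = [[]]"
| "strings (Suc n) = map (\<lambda>\<sigma>. False # \<sigma>) (strings n) @ map (\<lambda>\<sigma>. True # \<sigma>) (strings n)"

lemma set_strings: "set (strings n) = {\<sigma>. length \<sigma> = n}"
proof (induction n)
  case (Suc n)
  show ?case
  proof (intro set_eqI)
    fix \<sigma> :: "bool list"
    show "\<sigma> \<in> set (strings (Suc n)) \<longleftrightarrow> \<sigma> \<in> {\<sigma>. length \<sigma> = Suc n}"
      by (cases \<sigma>) (auto simp: Suc image_iff)
  qed
qed simp

lemma distinct_strings: "distinct (strings n)"
  by (induction n) (auto simp: distinct_map inj_on_def)

lemma computable_strings [computable_intros]:
  assumes "computable A k"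
  shows "computable A (\<lambda>x. strings (k x))"
proof -
  have "strings n = rec_nat [[]] (\<lambda>_ r. map (\<lambda>\<sigma>. False # \<sigma>) r @ map (\<lambda>\<sigma>. True # \<sigma>) r) n" for n
    by (induction n) auto
  then show ?thesis by (simp only:) (intro computable_intros assms)
qed

lemma measure_open_of_same_length:
  assumes "\<And>\<sigma>. \<sigma> \<in> U \<Longrightarrow> length \<sigma> = n"
  shows "\<mu> (open_of U) = (\<Sum>\<sigma>\<leftarrow>strings n. if \<sigma> \<in> U then (1 / 2) ^ n else 0)"
proof -
  have sub: "U \<subseteq> set (strings n)" using assms by (auto simp: set_strings)
  have "prefix_free U"
    unfolding prefix_free_def using assms by (metis not_equal_is_parallel parallelD1)
  from has_sum_prefix_free[OF this]
  have "\<mu> (open_of U) = (\<Sum>\<sigma>\<in>U. (1 / 2) ^ length \<sigma>)"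
    using finite_subset[OF sub] by (metis List.finite_set has_sum_finite has_sum_unique)
  also have "\<dots> = (\<Sum>\<sigma>\<in>set (strings n). if \<sigma> \<in> U then (1 / 2) ^ n else 0)"
    using sub assms by (intro sum.mono_neutral_cong_left) auto
  also have "\<dots> = (\<Sum>\<sigma>\<leftarrow>strings n. if \<sigma> \<in> U then (1 / 2) ^ n else 0)"
    by (rule sum_list_distinct_conv_sum_set[OF distinct_strings, symmetric])
  finally show ?thesis .
qed

lemma open_of_same_length:
  assumes "\<And>\<tau>. \<tau> \<in> U \<Longrightarrow> length \<tau> \<le> n"
  shows "open_of U = open_of {\<sigma>. length \<sigma> = n \<and> (\<exists>\<tau>\<in>U. prefix \<tau> \<sigma>)}"
proof
  show "open_of U \<subseteq> open_of {\<sigma>. length \<sigma> = n \<and> (\<exists>\<tau>\<in>U. prefix \<tau> \<sigma>)}"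
  proof
    fix X assume "X \<in> open_of U"
    then obtain k where k: "stake k X \<in> U" by (auto simp: open_of_def)
    then have "k \<le> n" using assms by fastforce
    then have "prefix (stake k X) (stake n X)"
      using take_is_prefix[of k "stake n X"] by (simp add: take_stake min_absorb1)
    then have "stake n X \<in> {\<sigma>. length \<sigma> = n \<and> (\<exists>\<tau>\<in>U. prefix \<tau> \<sigma>)}" using k by auto
    then show "X \<in> open_of {\<sigma>. length \<sigma> = n \<and> (\<exists>\<tau>\<in>U. prefix \<tau> \<sigma>)}" unfolding open_of_def by blast
  qed
  show "open_of {\<sigma>. length \<sigma> = n \<and> (\<exists>\<tau>\<in>U. prefix \<tau> \<sigma>)} \<subseteq> open_of U"
  proof
    fix X assume "X \<in> open_of {\<sigma>. length \<sigma> = n \<and> (\<exists>\<tau>\<in>U. prefix \<tau> \<sigma>)}"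
    then obtain k \<tau> where "\<tau> \<in> U" "prefix \<tau> (stake k X)" by (auto simp: open_of_def)
    then have "stake (length \<tau>) X = \<tau>"
      by (metis append_eq_conv_conj length_stake min_absorb1 prefix_def prefix_length_le take_stake)
    with \<open>\<tau> \<in> U\<close> show "X \<in> open_of U" unfolding open_of_def by (intro CollectI exI[of _ "length \<tau>"]) simp
  qed
qed

lemma computable_sum_nat:
  assumes f: "computable A (\<lambda>p. f (fst p) (snd p))" and k: "computable A k"
  shows "computable A (\<lambda>x. \<Sum>i<k x::nat. f x i :: nat)"
proof -
  have *: "(\<Sum>i<n. g i) = rec_nat 0 (\<lambda>i s. s + g i) n" for n and g :: "nat \<Rightarrow> nat"
    by (induction n) auto
  have "computable A (\<lambda>p::'a \<times> nat \<times> nat. f (fst p) (fst (snd p)))"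
    by (intro computable_compose2[OF f] computable_intros)
  then show ?thesis unfolding * by (intro computable_intros k)
qed

text \<open>
  If the strings \<open>f j\<close> with \<open>D j\<close> have a computable total weight \<open>r\<close>, counted with multiplicity, then
  the measure of the open set that they generate is computable, however much their cones overlap.
  Indeed, once the weight enumerated so far exceeds \<open>r - \<epsilon>\<close>, the strings still to come contribute
  measure at most \<open>\<epsilon>\<close>; and the measure of the finite union at hand is found by counting strings of
  one large length.
\<close>

lemma Schnorr_open_of_listing:
  fixes f :: "nat \<Rightarrow> bool list"
  assumes D: "semidec A D" and f: "computable A f"
    and sums: "(\<lambda>j. if D j then (1 / 2) ^ length (f j) else 0) sums r"
    and r: "computable_real A r"
  shows "Schnorr_open A (open_of {f j | j. D j})" "\<mu> (open_of {f j | j. D j}) \<le> r"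
proof -
  define g :: "nat \<Rightarrow> real" where "g j = (if D j then (1 / 2) ^ length (f j) else 0)" for j
  have g_sums: "g sums r" using sums by (simp add: g_def[abs_def])
  have g_nonneg: "0 \<le> g j" for j by (simp add: g_def)
  obtain R where R: "computable A (\<lambda>p. R (fst p) (snd p))" "\<And>j. D j \<longleftrightarrow> (\<exists>s::nat. R j s)"
    using D by (rule semidecE) blast
  \<comment> \<open>What has been enumerated after \<open>M\<close> stages.\<close>
  define E where "E M j \<longleftrightarrow> j < M \<and> (\<exists>s<M. R j s)" for M j :: nat
  have E_D: "E M j \<Longrightarrow> D j" for M j using R(2) by (auto simp: E_def)
  have cE: "computable A (\<lambda>p. E (fst p) (snd p))" unfolding E_def
    by (intro computable_bex_nat computable_compose2[OF R(1)] computable_intros)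
  define w :: "nat \<Rightarrow> rat" where "w M = (\<Sum>j<M. if E M j then (1 / 2) ^ length (f j) else 0)" for M
  have cw: "computable A w" unfolding w_def
    by (intro computable_sum_rat computable_if computable_compose2[OF cE] computable_compose[OF f] computable_intros)
  have w_eq: "of_rat (w M) = (\<Sum>j<M. if E M j then g j else 0)" for M
    unfolding w_def of_rat_sum
    by (intro sum.cong) (auto simp: g_def E_D of_rat_power of_rat_divide)
  have w_large: "\<exists>M. e < of_rat (w M)" if "e < r" for e
  proof -
    have "\<forall>\<^sub>F n in sequentially. e < sum g {..<n}"
      using g_sums that unfolding sums_def by (rule order_tendstoD)
    then obtain n where n: "e < sum g {..<n}" by (auto simp: eventually_sequentially)
    have "\<forall>j. \<exists>s. D j \<longrightarrow> R j s" using R(2) by blast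
    then obtain s where s: "\<And>j. D j \<Longrightarrow> R j (s j)" by metis
    define M where "M = Suc (Max (insert n (s ` {..<n})))"
    have M: "n \<le> M" "\<And>j. j < n \<Longrightarrow> s j < M"
      unfolding M_def by (auto simp: less_Suc_eq_le intro!: le_SucI Max_ge)
    have "sum g {..<n} = (\<Sum>j<n. if E M j then g j else 0)"
      using M s by (intro sum.cong) (auto simp: E_def g_def)
    also have "\<dots> \<le> (\<Sum>j<M. if E M j then g j else 0)"
      using M(1) g_nonneg by (intro sum_mono2) auto
    finally show ?thesis using n unfolding w_eq[symmetric] by (intro exI[of _ M]) simp
  qed
  define S where "S = open_of {f j | j. D j}"
  define SM where "SM M = open_of {f j | j. E M j}" for M
  have SM_le: "\<mu> (SM M) \<le> \<mu> S" for M
    unfolding SM_def S_def using E_D by (intro cantor.finite_measure_mono open_of_mono) auto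
  \<comment> \<open>The remaining cones cover the rest of \<open>S\<close> and have total weight \<open>r - w M\<close>.\<close>
  have S_le: "\<mu> S \<le> \<mu> (SM M) + (r - of_rat (w M))" for M
  proof -
    define C where "C j = (if D j \<and> \<not> E M j then prepend (f j) UNIV else {})" for j
    have C_sets: "C j \<in> sets cantor_measure" for j by (auto simp: C_def)
    have "(\<lambda>j. if E M j then g j else 0) sums (\<Sum>j<M. if E M j then g j else 0)"
      by (rule sums_finite) (auto simp: E_def)
    from sums_diff[OF g_sums this]
    have "(\<lambda>j. g j - (if E M j then g j else 0)) sums (r - of_rat (w M))" by (simp add: w_eq)
    moreover have "g j - (if E M j then g j else 0) = \<mu> (C j)" for j
      by (auto simp: C_def g_def measure_cylinder dest: E_D)
    ultimately have C_sums: "(\<lambda>j. \<mu> (C j)) sums (r - of_rat (w M))" by simp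
    have "S \<subseteq> SM M \<union> (\<Union>j. C j)"
      unfolding S_def SM_def open_of_conv_prepend C_def by (auto split: if_splits)
    then have "\<mu> S \<le> \<mu> (SM M \<union> (\<Union>j. C j))"
      using C_sets by (intro cantor.finite_measure_mono) (auto simp: SM_def)
    also have "\<dots> \<le> \<mu> (SM M) + \<mu> (\<Union>j. C j)"
      using C_sets by (intro measure_Un_le) (auto simp: SM_def)
    also have "\<mu> (\<Union>j. C j) \<le> (\<Sum>j. \<mu> (C j))"
      using C_sets C_sums by (intro cantor.finite_measure_subadditive_countably) (auto simp: sums_iff)
    also have "(\<Sum>j. \<mu> (C j)) = r - of_rat (w M)" using C_sums by (simp add: sums_iff)
    finally show ?thesis by simp
  qed
  have "SM 0 = {}" "w 0 = 0" by (auto simp: SM_def E_def w_def open_of_def)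
  with S_le[of 0] show "\<mu> (open_of {f j | j. D j}) \<le> r" by (simp add: S_def)
  obtain a where a: "computable A a" "\<And>n. \<bar>of_rat (a n) - r\<bar> \<le> (1 / 2) ^ n"
    using r unfolding computable_real_iff by blast
  have a_close: "\<bar>of_rat (a (t + 2)) - r\<bar> \<le> (1 / 2) ^ t / 4" for t
    using a(2)[of "t + 2"] by simp
  have half: "(1 / 2 :: real) ^ (t + 1) = (1 / 2) ^ t / 2" "0 < (1 / 2 :: real) ^ t" for t by simp_all
  \<comment> \<open>A stage whose missing weight is below \<open>2\<^sup>-\<^sup>t\<close>: a quarter of this pays for the error of \<open>a\<close>, a half for the threshold.\<close>
  define m where "m t = (LEAST M. a (t + 2) - (1 / 2) ^ (t + 1) < w M)" for t
  have m_ex: "\<exists>M. a (t + 2) - (1 / 2) ^ (t + 1) < w M" for t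
  proof -
    have "of_rat (a (t + 2)) - (1 / 2) ^ (t + 1) < r"
      using a_close[of t] half[of t] by linarith
    then obtain M where "of_rat (a (t + 2)) - (1 / 2) ^ (t + 1) < real_of_rat (w M)"
      using w_large by blast
    then have "real_of_rat (a (t + 2) - (1 / 2) ^ (t + 1)) < real_of_rat (w M)"
      by (simp add: of_rat_diff of_rat_power of_rat_divide)
    then show ?thesis by (auto simp: of_rat_less)
  qed
  have cm: "computable A m"
    unfolding m_def
    by (rule computable_Least[OF _ m_ex])
      (intro computable_less_rat computable_diff_rat computable_compose[OF a(1)] computable_compose[OF cw]
        computable_intros)
  have m: "r - (1 / 2) ^ t < of_rat (w (m t))" for t
  proof -
    have "a (t + 2) - (1 / 2) ^ (t + 1) < w (m t)" unfolding m_def by (rule LeastI_ex[OF m_ex])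
    then have "real_of_rat (a (t + 2) - (1 / 2) ^ (t + 1)) < real_of_rat (w (m t))"
      by (simp only: of_rat_less)
    then have "of_rat (a (t + 2)) - (1 / 2) ^ (t + 1) < real_of_rat (w (m t))"
      by (simp add: of_rat_diff of_rat_power of_rat_divide)
    with a_close[of t] half[of t] show ?thesis by linarith
  qed
  \<comment> \<open>The sum of the lengths is a crude common bound for all of them.\<close>
  define L where "L M = (\<Sum>j<M. length (f j))" for M
  define b :: "nat \<Rightarrow> rat" where
    "b M = (\<Sum>\<sigma>\<leftarrow>strings (L M). if \<exists>j<M. E M j \<and> prefix (f j) \<sigma> then (1 / 2) ^ L M else 0)" for M
  have cL: "computable A L" unfolding L_def
    by (intro computable_sum_nat computable_compose[OF f] computable_intros)
  have cb: "computable A b" unfolding b_def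
    by (intro computable_sum_list_rat computable_if computable_bex_nat computable_conj
      computable_compose2[OF cE] computable_prefix computable_compose[OF f] computable_compose[OF cL] computable_intros)
  have b_eq: "of_rat (b M) = \<mu> (SM M)" for M
  proof -
    have "length (f j) \<le> L M" if "j < M" for j
      unfolding L_def using that by (intro member_le_sum) auto
    then have "SM M = open_of {\<sigma>. length \<sigma> = L M \<and> (\<exists>\<tau>\<in>{f j | j. E M j}. prefix \<tau> \<sigma>)}"
      unfolding SM_def by (intro open_of_same_length) (auto simp: E_def)
    then have "\<mu> (SM M) = (\<Sum>\<sigma>\<leftarrow>strings (L M).
        if \<sigma> \<in> {\<sigma>. length \<sigma> = L M \<and> (\<exists>\<tau>\<in>{f j | j. E M j}. prefix \<tau> \<sigma>)} then (1 / 2) ^ L M else 0)"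
      using measure_open_of_same_length[of "{\<sigma>. length \<sigma> = L M \<and> (\<exists>\<tau>\<in>{f j | j. E M j}. prefix \<tau> \<sigma>)}" "L M"]
      by simp
    also have "\<dots> = (\<Sum>\<sigma>\<leftarrow>strings (L M). of_rat (if \<exists>j<M. E M j \<and> prefix (f j) \<sigma> then (1 / 2) ^ L M else 0))"
      by (intro arg_cong[of _ _ sum_list] map_cong refl)
        (auto simp: set_strings E_def of_rat_power of_rat_divide)
    also have "\<dots> = of_rat (b M)"
    proof -
      have "(\<Sum>\<sigma>\<leftarrow>l. real_of_rat (h \<sigma>)) = of_rat (\<Sum>\<sigma>\<leftarrow>l. h \<sigma>)" for l and h :: "bool list \<Rightarrow> rat"
        by (induction l) (auto simp: of_rat_add)
      then show ?thesis unfolding b_def .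
    qed
    finally show ?thesis by simp
  qed
  have "\<bar>of_rat (b (m t)) - \<mu> S\<bar> \<le> (1 / 2) ^ t" for t
    unfolding b_eq using SM_le[of "m t"] S_le[of "m t"] m[of t] by (simp add: abs_le_iff)
  moreover have "computable A (\<lambda>t. b (m t))" by (rule computable_compose[OF cb cm])
  ultimately have "computable_real A (\<mu> S)" unfolding computable_real_iff by blast
  moreover have "semidec A (\<lambda>\<sigma>. \<exists>j. D j \<and> f j = \<sigma>)"
    by (intro semidec_ex semidec_conj semidec_compose[OF D] computable_imp_semidec
      computable_eq_string computable_compose[OF f] computable_intros)
  moreover have "(\<lambda>\<sigma>. \<exists>j. D j \<and> f j = \<sigma>) = (\<lambda>\<sigma>. \<sigma> \<in> {f j | j. D j})" by auto
  ultimately show "Schnorr_open A (open_of {f j | j. D j})"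
    unfolding S_def by (intro Schnorr_openI) simp_all
qed

section \<open>A Schnorr open set containing all tails\<close>

text \<open>
  Every string of \<open>W (2 n + 2)\<close> has length at least \<open>2 n + 2\<close>, so dropping its first \<open>n\<close> bits
  multiplies its weight by exactly \<open>2\<^sup>n\<close>. The shortened strings thus have weight
  \<open>2\<^sup>n 2\<^bsup>-(2n+2)\<^esup> = 2\<^bsup>-(n+2)\<^esup>\<close> for each \<open>n\<close>, and total weight \<open>1/2\<close>.
\<close>

lemma Schnorr_open_tails:
  assumes T: "Schnorr_test A T" and X: "X \<in> (\<Inter>n. T n)"
  shows "\<exists>S. bounded_open S \<and> Schnorr_open A S \<and> (\<forall>n. sdrop n X \<in> S)"
proof -
  obtain W where W: "semidec A (\<lambda>p. snd p \<in> W (fst p))" "\<And>n. prefix_free (W n)" "\<And>n. T n = open_of (W n)"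
    using T unfolding Schnorr_test_def uniformly_ce_open_def uniformly_ce_strings_iff_semidec by blast
  have \<mu>W: "\<mu> (open_of (W n)) = (1 / 2) ^ n" for n
    using T W(3) by (simp add: Schnorr_test_def)
  have len: "n \<le> length \<sigma>" if "\<sigma> \<in> W n" for \<sigma> n
  proof -
    have "prepend \<sigma> UNIV \<subseteq> open_of (W n)"
      unfolding open_of_conv_prepend using that by (rule UN_upper)
    from cantor.finite_measure_mono[OF this sets_open_of]
    show ?thesis unfolding \<mu>W measure_cylinder by (simp add: power_decreasing_iff)
  qed
  \<comment> \<open>Only canonical string codes are listed, so that each pair \<open>(n, \<sigma>)\<close> is counted once.\<close>
  define D where "D j \<longleftrightarrow> string_code (decode (snd (prod_decode j))) = snd (prod_decode j)
    \<and> decode (snd (prod_decode j)) \<in> W (2 * fst (prod_decode j) + 2)" for j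
  define f :: "nat \<Rightarrow> bool list" where "f j = drop (fst (prod_decode j)) (decode (snd (prod_decode j)))" for j
  note decode' = computable_compose[OF computable_decode]
  have D: "semidec A D"
    unfolding D_def
  proof (rule semidec_conj, rule computable_imp_semidec)
    show "computable A (\<lambda>j. string_code (decode (snd (prod_decode j))) = snd (prod_decode j))"
      by (intro computable_intros decode')
    have "computable A (\<lambda>j. (2 * fst (prod_decode j) + 2, decode (snd (prod_decode j)) :: bool list))"
      by (intro computable_intros decode')
    from semidec_compose[OF W(1) this]
    show "semidec A (\<lambda>j. decode (snd (prod_decode j)) \<in> W (2 * fst (prod_decode j) + 2))" by simp
  qed
  have f: "computable A f" unfolding f_def by (intro computable_intros decode')
  let ?w = "\<lambda>p. (1 / 2) ^ length (drop (fst p) (snd p :: bool list)) :: real"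
  let ?I = "SIGMA n:UNIV. W (2 * n + 2)"
  have inner: "((\<lambda>\<sigma>. ?w (n, \<sigma>)) has_sum (1 / 2) ^ (n + 2)) (W (2 * n + 2))" for n
  proof -
    have sum: "((\<lambda>\<sigma>. 2 ^ n * (1 / 2) ^ length \<sigma>) has_sum (2 ^ n * (1 / 2) ^ (2 * n + 2) :: real)) (W (2 * n + 2))"
      using has_sum_cmult_right[OF has_sum_prefix_free[OF W(2)], of "2 ^ n" "2 * n + 2"] unfolding \<mu>W .
    have eq: "2 ^ n * (1 / 2) ^ length \<sigma> = ?w (n, \<sigma>)" if "\<sigma> \<in> W (2 * n + 2)" for \<sigma>
    proof -
      have "length \<sigma> = n + (length \<sigma> - n)" using len[OF that] by simp
      then have "(1 / 2 :: real) ^ length \<sigma> = (1 / 2) ^ n * (1 / 2) ^ (length \<sigma> - n)"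
        by (metis power_add)
      then show ?thesis by (simp add: power_one_over)
    qed
    have "(2 ^ n * (1 / 2) ^ (2 * n + 2) :: real) = (1 / 2) ^ (n + 2)"
    proof -
      have "(1 / 2 :: real) ^ (2 * n + 2) = (1 / 2) ^ n * (1 / 2) ^ (n + 2)"
        unfolding power_add[symmetric] by (simp add: mult_2)
      then show ?thesis by (simp add: power_one_over)
    qed
    with sum have "((\<lambda>\<sigma>. 2 ^ n * (1 / 2) ^ length \<sigma>) has_sum (1 / 2 :: real) ^ (n + 2)) (W (2 * n + 2))"
      by simp
    then show ?thesis by (rule has_sum_cong[THEN iffD1, rotated]) (rule eq)
  qed
  have outer: "((\<lambda>n. (1 / 2) ^ (n + 2)) has_sum (1 / 2 :: real)) UNIV"
  proof (rule sums_nonneg_imp_has_sum)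
    show "(\<lambda>n. (1 / 2 :: real) ^ (n + 2)) sums (1 / 2)"
      using sums_mult[OF geometric_sums[of "1 / 2 :: real"], of "1 / 4"] by (simp add: power_add mult.commute)
  qed simp
  have "(?w has_sum 1 / 2) ?I"
  proof (rule has_sum_SigmaI[where f = ?w and g = "\<lambda>n. (1 / 2) ^ (n + 2)"])
    show "((\<lambda>n. (1 / 2) ^ (n + 2)) has_sum (1 / 2 :: real)) UNIV" by (rule outer)
    show "?w summable_on ?I"
      by (rule summable_on_SigmaI[where f = ?w, OF inner has_sum_imp_summable[OF outer]]) simp
  qed (rule inner)
  define h where "h p = prod_encode (fst p, string_code (snd p))" for p :: "nat \<times> bool list"
  have "inj_on h ?I" by (auto simp: inj_on_def h_def)
  moreover have "((\<lambda>j. if D j then (1 / 2) ^ length (f j) else 0 :: real) \<circ> h has_sum 1 / 2) ?I"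
    using \<open>(?w has_sum 1 / 2) ?I\<close> by (rule has_sum_cong[THEN iffD1, rotated]) (auto simp: h_def D_def f_def)
  ultimately have "((\<lambda>j. if D j then (1 / 2) ^ length (f j) else 0 :: real) has_sum 1 / 2) (h ` ?I)"
    by (simp add: has_sum_reindex)
  moreover have "((\<lambda>j. if D j then (1 / 2) ^ length (f j) else 0 :: real) has_sum 1 / 2) (h ` ?I)
      \<longleftrightarrow> ((\<lambda>j. if D j then (1 / 2) ^ length (f j) else 0 :: real) has_sum 1 / 2) UNIV"
  proof (rule has_sum_cong_neutral)
    fix j assume "j \<in> UNIV - h ` ?I"
    moreover have "j = h (fst (prod_decode j), decode (snd (prod_decode j)))" if "D j"
      using that by (simp add: D_def h_def)
    ultimately show "(if D j then (1 / 2) ^ length (f j) else 0 :: real) = 0"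
      by (auto simp: D_def image_iff split: if_splits)
  qed auto
  ultimately have sums: "(\<lambda>j. if D j then (1 / 2) ^ length (f j) else 0 :: real) sums (1 / 2)"
    by (intro has_sum_imp_sums) blast
  have "computable_real A (1 / 2)"
    unfolding computable_real_iff
    by (intro exI[of _ "\<lambda>_. 1 / 2"] conjI computable_const) (simp add: of_rat_divide)
  note S = Schnorr_open_of_listing[OF D f sums this]
  have "sdrop n X \<in> open_of {f j | j. D j}" for n
  proof -
    have "X \<in> open_of (W (2 * n + 2))" using X W(3) by auto
    then obtain k where k: "stake k X \<in> W (2 * n + 2)" by (auto simp: open_of_def)
    have "f (h (n, stake k X)) = stake (k - n) (sdrop n X)"
      by (simp add: f_def h_def drop_stake)
    moreover have "D (h (n, stake k X))" using k by (simp add: D_def h_def)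
    ultimately have "stake (k - n) (sdrop n X) \<in> {f j | j. D j}"
      by (intro CollectI exI[of _ "h (n, stake k X)"]) simp
    then show ?thesis unfolding open_of_def by blast
  qed
  moreover have "bounded_open (open_of {f j | j. D j})"
    using S(2) by (auto simp: bounded_open_def)
  ultimately show ?thesis using S(1) by blast
qed

section \<open>Restarting a winning martingale\<close>

lemma succeeds_onI:
  assumes "\<And>B. \<exists>n. B \<le> d (stake n X)"
  shows "succeeds_on d X"
proof (rule ccontr)
  assume "\<not> succeeds_on d X"
  then have "limsup (\<lambda>n. ereal (d (stake n X))) < \<infinity>" by (simp add: succeeds_on_def less_top)
  then obtain B where "limsup (\<lambda>n. ereal (d (stake n X))) < ereal B"
    using less_PInf_Ex_of_nat[of "limsup (\<lambda>n. ereal (d (stake n X)))"] by auto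
  then have "\<forall>\<^sub>F n in sequentially. ereal (d (stake n X)) < ereal B" by (rule Limsup_lessD)
  then obtain N where N: "\<And>n. n \<ge> N \<Longrightarrow> d (stake n X) < B" by (auto simp: eventually_sequentially)
  define C where "C = Max (insert B ((\<lambda>n. d (stake n X)) ` {..<N}))"
  have C: "B \<le> C" "\<And>n. n < N \<Longrightarrow> d (stake n X) \<le> C" by (auto simp: C_def intro!: Max_ge)
  obtain n where "C + 1 \<le> d (stake n X)" using assms by blast
  with C(2)[of n] C(1) N[of n] show False by (cases "n < N") auto
qed

lemma not_succeeds_onI:
  assumes "\<And>n. n \<ge> N \<Longrightarrow> d (stake n X) \<le> B"
  shows "\<not> succeeds_on d X"
proof -
  have "limsup (\<lambda>n. ereal (d (stake n X))) \<le> ereal B"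
    using assms by (intro Limsup_bounded) (auto simp: eventually_sequentially)
  then show ?thesis by (auto simp: succeeds_on_def)
qed

context
  fixes f :: "bool list \<Rightarrow> rat" and q :: rat
begin

text \<open>
  The state consists of the bits read since the last restart and the capital at that moment.
\<close>

definition restart_step :: "bool list \<times> rat \<Rightarrow> bool \<Rightarrow> bool list \<times> rat" where
  "restart_step s b = (if q \<le> f (fst s @ [b]) then ([], snd s * f (fst s @ [b])) else (fst s @ [b], snd s))"

definition restart_state :: "bool list \<Rightarrow> bool list \<times> rat" where
  "restart_state \<sigma> = foldl restart_step ([], 1) \<sigma>"

definition restart :: "bool list \<Rightarrow> rat" where
  "restart \<sigma> = snd (restart_state \<sigma>) * f (fst (restart_state \<sigma>))"

end

lemma computable_restart:
  assumes "computable A f"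
  shows "computable A (restart f q)"
proof -
  have "computable A (restart_state f q)"
    unfolding restart_state_def restart_step_def
    by (intro computable_foldl computable_if computable_le_rat computable_mult_rat computable_Pair
      computable_compose[OF assms] computable_intros)
  then show ?thesis unfolding restart_def
    by (intro computable_mult_rat computable_compose[OF assms] computable_fst computable_snd)
qed

text \<open>
  Since \<open>f [] = 1\<close>, a restart leaves the value of the martingale unchanged; hence each bet is the
  bet of \<open>f\<close> after the bits read since the last restart, scaled by a constant.
\<close>

lemma martingale_restart:
  assumes "martingale (\<lambda>\<sigma>. of_rat (f \<sigma>))" "f [] = 1"
  shows "martingale (\<lambda>\<sigma>. of_rat (restart f q \<sigma>))"
proof -
  have f: "f \<sigma> \<ge> 0" "f \<sigma> = (f (\<sigma> @ [False]) + f (\<sigma> @ [True])) / 2" for \<sigma>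
  proof -
    have "real_of_rat (f \<sigma>) = real_of_rat ((f (\<sigma> @ [False]) + f (\<sigma> @ [True])) / 2)"
      using assms(1) unfolding martingale_def by (simp add: of_rat_add of_rat_divide)
    then show "f \<sigma> = (f (\<sigma> @ [False]) + f (\<sigma> @ [True])) / 2" by (simp only: of_rat_eq_iff)
    show "f \<sigma> \<ge> 0" using assms(1) unfolding martingale_def by simp
  qed
  have snd_nonneg: "0 \<le> snd (restart_state f q \<sigma>)" for \<sigma>
    by (induction \<sigma> rule: rev_induct) (auto simp: restart_state_def restart_step_def f(1))
  have step: "restart f q (\<sigma> @ [b]) = snd (restart_state f q \<sigma>) * f (fst (restart_state f q \<sigma>) @ [b])" for \<sigma> b
    by (auto simp: restart_def restart_state_def restart_step_def assms(2))
  have "restart f q \<sigma> = (restart f q (\<sigma> @ [False]) + restart f q (\<sigma> @ [True])) / 2" for \<sigma>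
    unfolding step unfolding restart_def f(2)[of "fst (restart_state f q \<sigma>)"] by (simp add: algebra_simps)
  moreover have "0 \<le> restart f q \<sigma>" for \<sigma>
    unfolding restart_def by (intro mult_nonneg_nonneg snd_nonneg f)
  ultimately show ?thesis
    unfolding martingale_def by (metis of_rat_add of_rat_divide of_rat_numeral_eq zero_le_of_rat_iff)
qed

text \<open>
  After a restart, what is left of \<open>X\<close> is a tail of \<open>X\<close>, on which \<open>f\<close> reaches \<open>q\<close> again. The first
  time that this happens is the next restart, and the capital has then grown by a factor of at
  least \<open>q\<close>.
\<close>

lemma restart_unbounded:
  assumes q: "q > 1" and f: "f [] = 1"
    and win: "\<And>n. \<exists>k. q \<le> f (stake k (sdrop n X))"
  shows "\<exists>k. q ^ n \<le> restart f q (stake k X)"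
proof -
  have "\<exists>k c. restart_state f q (stake k X) = ([], c) \<and> q ^ n \<le> c"
  proof (induction n)
    case 0
    show ?case by (rule exI[of _ 0], rule exI[of _ 1]) (simp add: restart_state_def)
  next
    case (Suc n)
    then obtain k c where kc: "restart_state f q (stake k X) = ([], c)" "q ^ n \<le> c" by blast
    define Y where "Y = sdrop k X"
    define i where "i = (LEAST i. q \<le> f (stake i Y))"
    have i: "q \<le> f (stake i Y)" 
      unfolding i_def using LeastI_ex[of "\<lambda>i. q \<le> f (stake i Y)"] win[of k] unfolding Y_def by blast
    have "i \<noteq> 0"
    proof
      assume "i = 0"
      then have "q \<le> 1" using i f by simp
      with q show False by simp
    qed
    then obtain i' where i': "i = Suc i'" by (cases i) auto
    have less: "f (stake l Y) < q" if "l < i" for l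
      using not_less_Least[of l "\<lambda>i. q \<le> f (stake i Y)"] that by (simp add: i_def not_le)
    have state: "restart_state f q (stake (k + l) X) = (stake l Y, c)" if "l < i" for l
      using that
    proof (induction l)
      case 0
      then show ?case using kc by simp
    next
      case (Suc l)
      have "stake (k + Suc l) X = stake (k + l) X @ [Y !! l]"
        by (simp add: stake_Suc Y_def sdrop_snth add.commute del: stake.simps)
      moreover have "stake (Suc l) Y = stake l Y @ [Y !! l]" by (simp add: stake_Suc del: stake.simps)
      ultimately show ?case using Suc less[OF Suc.prems]
        by (simp add: restart_state_def restart_step_def del: stake.simps)
    qed
    have e: "stake (k + i) X = stake (k + i') X @ [Y !! i']"
      by (simp add: i' stake_Suc Y_def sdrop_snth add.commute del: stake.simps)
    have "stake i Y = stake i' Y @ [Y !! i']" by (simp add: i' stake_Suc del: stake.simps)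
    then have "restart_state f q (stake (k + i) X) = ([], c * f (stake i Y))"
      using state[of i'] i i' unfolding e
      by (simp add: restart_state_def restart_step_def del: stake.simps)
    moreover have "q ^ Suc n \<le> c * f (stake i Y)"
    proof -
      have "q ^ n * q \<le> c * f (stake i Y)"
        using kc(2) i q by (intro mult_mono) (auto intro: order.trans[OF _ kc(2)])
      then show ?thesis by (simp add: mult.commute)
    qed
    ultimately show ?case by blast
  qed
  then obtain k c where "restart_state f q (stake k X) = ([], c)" "q ^ n \<le> c" by blast
  then have "q ^ n \<le> restart f q (stake k X)" by (simp add: restart_def f)
  then show ?thesis ..
qed

lemma winning_open_covers_tails:
  assumes V: "winning_open V" and tails: "\<And>n. sdrop n X \<in> V"
  shows "X \<notin> CR"
proof -
  obtain d q where d: "martingale d" "d [] = 1" "exactly_computable d" and q: "q > (1::rat)"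
    and V: "V = open_of {\<sigma>. minimal_string (\<lambda>\<tau>. of_rat q \<le> d \<tau>) \<sigma>}"
    using V unfolding winning_open_def normed_def by blast
  obtain f where f: "computable no_oracle f" and df: "d = (\<lambda>\<sigma>. of_rat (f \<sigma>))"
    using d(3) exactly_computable_iff by blast
  have f1: "f [] = 1" using d(2) by (simp add: df)
  have win: "\<exists>k. q \<le> f (stake k (sdrop n X))" for n
    using tails[of n] by (auto simp: V open_of_def minimal_string_def df of_rat_less_eq)
  have "exactly_computable (\<lambda>\<sigma>. of_rat (restart f q \<sigma>))"
    unfolding exactly_computable_iff using computable_restart[OF f] by blast
  then have "computable_string_real no_oracle (\<lambda>\<sigma>. of_rat (restart f q \<sigma>))"
    by (rule exactly_computable_imp_computable_string_real)
  moreover have "martingale (\<lambda>\<sigma>. of_rat (restart f q \<sigma>))"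
    using martingale_restart[of f q] d(1) f1 by (simp add: df)
  moreover have "succeeds_on (\<lambda>\<sigma>. of_rat (restart f q \<sigma>)) X"
  proof (rule succeeds_onI)
    fix B :: real
    have "1 < real_of_rat q" using q by simp
    then obtain n where "B < real_of_rat q ^ n" using real_arch_pow by blast
    moreover obtain k where "q ^ n \<le> restart f q (stake k X)" using restart_unbounded[OF q f1 win] by blast
    then have "real_of_rat (q ^ n) \<le> of_rat (restart f q (stake k X))" by (simp only: of_rat_less_eq)
    ultimately have "B \<le> of_rat (restart f q (stake k X))" by (simp add: of_rat_power)
    then show "\<exists>n. B \<le> of_rat (restart f q (stake n X))" ..
  qed
  ultimately show ?thesis unfolding CR_def by blast
qed

lemma covering_imp_Low:
  assumes "\<And>S. bounded_open S \<Longrightarrow> Schnorr_open A S \<Longrightarrow> \<exists>V. winning_open V \<and> S \<subseteq> V"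
  shows "A \<in> Low CR SR"
proof -
  have "X \<in> SR A" if "X \<in> CR" for X
    unfolding SR_def
  proof (intro CollectI allI impI notI)
    fix T assume "Schnorr_test A T" "X \<in> (\<Inter>n. T n)"
    from Schnorr_open_tails[OF this] obtain S where
      S: "bounded_open S" "Schnorr_open A S" "\<And>n. sdrop n X \<in> S" by blast
    from assms[OF S(1,2)] obtain V where "winning_open V" "S \<subseteq> V" by blast
    with winning_open_covers_tails[of V X] S(3) that show False by blast
  qed
  then show ?thesis by (auto simp: Low_def)
qed

section \<open>Exactly computable martingales\<close>

text \<open>
  Rational approximations \<open>b\<close> of \<open>d\<close> are not a martingale, but their differences
  \<open>b (\<sigma> 0) - b (\<sigma> 1)\<close> may serve as bets. The martingale \<open>F\<close> that makes these bets follows \<open>d\<close> up to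
  the accumulated approximation errors. With precision \<open>2\<^sup>-\<^sup>n\<close> on strings of length \<open>n\<close> these errors
  have a finite sum, so an additive constant in the initial capital keeps \<open>F\<close> above \<open>d\<close>.
\<close>

lemma computable_martingale_dominated:
  assumes mart: "martingale d" and comp: "computable_string_real no_oracle d"
  shows "\<exists>D. exactly_computable D \<and> martingale D \<and> (\<forall>\<sigma>. d \<sigma> \<le> D \<sigma>)"
proof -
  obtain a where a: "computable no_oracle (\<lambda>p. a (fst p) (snd p))"
    "\<And>\<sigma> n. \<bar>of_rat (a \<sigma> n) - d \<sigma>\<bar> \<le> (1 / 2) ^ n"
    using computable_string_realD[OF comp] by blast
  define b where "b \<sigma> = a \<sigma> (length \<sigma>)" for \<sigma>
  have cb: "computable no_oracle b" unfolding b_def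
    by (intro computable_compose2[OF a(1)] computable_intros)
  define step :: "bool list \<times> rat \<Rightarrow> bool \<Rightarrow> bool list \<times> rat" where
    "step s x = (fst s @ [x], snd s + (b (fst s @ [x]) - b (fst s @ [\<not> x])) / 2)" for s x
  define F where "F \<sigma> = snd (foldl step ([], b [] + 4) \<sigma>)" for \<sigma>
  have cF: "computable no_oracle F"
    unfolding F_def step_def
    by (intro computable_snd computable_foldl computable_Pair computable_append computable_add_rat
      computable_divide_rat computable_diff_rat computable_compose[OF cb] computable_intros)
  have fst_state: "fst (foldl step ([], b [] + 4) \<sigma>) = \<sigma>" for \<sigma>
    by (induction \<sigma> rule: rev_induct) (auto simp: step_def)
  have F_Nil: "F [] = b [] + 4" by (simp add: F_def)
  have F_snoc: "F (\<sigma> @ [x]) = F \<sigma> + (b (\<sigma> @ [x]) - b (\<sigma> @ [\<not> x])) / 2" for \<sigma> x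
    by (simp add: F_def step_def fst_state)
  have close: "\<bar>of_rat (b \<sigma>) - d \<sigma>\<bar> \<le> (1 / 2) ^ length \<sigma>" for \<sigma>
    unfolding b_def by (rule a)
  have avg: "d \<sigma> = (d (\<sigma> @ [False]) + d (\<sigma> @ [True])) / 2" for \<sigma>
    using mart unfolding martingale_def by blast
  \<comment> \<open>The margin may shrink by \<open>p / 2\<close> in the step, while the claimed lower bound drops by \<open>p\<close>.\<close>
  have arith: "1 + 2 * (p / 2) \<le> F' - u"
    if "u = w + (u - v) / 2" "F' = F0 + (b1 - b2) / 2" "\<bar>b1 - u\<bar> \<le> p / 2" "\<bar>b2 - v\<bar> \<le> p / 2"
      "0 < p" "1 + 2 * p \<le> F0 - w" for u v w F' F0 b1 b2 p :: real
  proof -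
    have "F' - u = (F0 - w) + ((b1 - u) - (b2 - v)) / 2"
      using that(1,2) by (simp add: field_simps)
    moreover have "- (p / 2) \<le> b1 - u" "b2 - v \<le> p / 2" 
      using abs_le_D2[OF that(3)] abs_le_D1[OF that(4)] by simp_all
    ultimately show ?thesis using that(5,6) by argo
  qed
  have gap: "1 + 2 * (1 / 2) ^ length \<sigma> \<le> of_rat (F \<sigma>) - d \<sigma>" for \<sigma>
  proof (induction \<sigma> rule: rev_induct)
    case Nil
    then show ?case using close[of "[]"] by (simp add: F_Nil of_rat_add)
  next
    case (snoc x \<sigma>)
    have "d (\<sigma> @ [x]) = d \<sigma> + (d (\<sigma> @ [x]) - d (\<sigma> @ [\<not> x])) / 2"
      using avg[of \<sigma>] by (cases x) (simp_all add: field_simps)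
    moreover
    have "real_of_rat (F (\<sigma> @ [x])) = of_rat (F \<sigma>) + (of_rat (b (\<sigma> @ [x])) - of_rat (b (\<sigma> @ [\<not> x]))) / 2"
      by (simp add: F_snoc of_rat_add of_rat_diff of_rat_divide)
    moreover have "\<bar>of_rat (b (\<sigma> @ [y])) - d (\<sigma> @ [y])\<bar> \<le> (1 / 2) ^ length \<sigma> / 2" for y
      using close[of "\<sigma> @ [y]"] by simp
    from this[of x] this[of "\<not> x"]
    have "\<bar>of_rat (b (\<sigma> @ [x])) - d (\<sigma> @ [x])\<bar> \<le> (1 / 2) ^ length \<sigma> / 2"
      "\<bar>of_rat (b (\<sigma> @ [\<not> x])) - d (\<sigma> @ [\<not> x])\<bar> \<le> (1 / 2) ^ length \<sigma> / 2" .
    moreover have "0 < (1 / 2 :: real) ^ length \<sigma>" by simp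
    ultimately have "1 + 2 * ((1 / 2) ^ length \<sigma> / 2) \<le> of_rat (F (\<sigma> @ [x])) - d (\<sigma> @ [x])"
      using snoc by (rule arith)
    then show ?case by simp
  qed
  have le: "d \<sigma> \<le> of_rat (F \<sigma>)" for \<sigma>
    using gap[of \<sigma>] zero_less_power[of "1 / 2 :: real" "length \<sigma>"] by linarith
  have "martingale (\<lambda>\<sigma>. of_rat (F \<sigma>))"
    unfolding martingale_def
  proof (intro allI conjI)
    fix \<sigma>
    have "0 \<le> d \<sigma>" using mart unfolding martingale_def by blast
    then show "0 \<le> real_of_rat (F \<sigma>)" using le[of \<sigma>] by linarith
    show "real_of_rat (F \<sigma>) = (of_rat (F (\<sigma> @ [False])) + of_rat (F (\<sigma> @ [True]))) / 2"
    proof -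
      have "F \<sigma> = (F (\<sigma> @ [False]) + F (\<sigma> @ [True])) / 2" by (simp add: F_snoc field_simps)
      then have "real_of_rat (F \<sigma>) = of_rat ((F (\<sigma> @ [False]) + F (\<sigma> @ [True])) / 2)" by (rule arg_cong)
      then show ?thesis by (simp only: of_rat_add of_rat_divide of_rat_numeral_eq)
    qed
  qed
  moreover have "exactly_computable (\<lambda>\<sigma>. of_rat (F \<sigma>))"
    unfolding exactly_computable_iff using cF by blast
  ultimately show ?thesis using le by blast
qed

lemma exactly_computable_const: "exactly_computable (\<lambda>_. 1)"
  unfolding exactly_computable_iff by (intro exI[of _ "\<lambda>_. 1"] conjI computable_const) simp

lemma exactly_computable_add_scaled:
  assumes "exactly_computable d" "exactly_computable m"
  shows "exactly_computable (\<lambda>\<sigma>. d \<sigma> + of_rat e * m \<sigma>)"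
proof -
  obtain f g where fg: "computable no_oracle f" "d = (\<lambda>\<sigma>. of_rat (f \<sigma>))"
    "computable no_oracle g" "m = (\<lambda>\<sigma>. of_rat (g \<sigma>))"
    using assms unfolding exactly_computable_iff by blast
  have "computable no_oracle (\<lambda>\<sigma>. f \<sigma> + e * g \<sigma>)" by (intro computable_intros fg)
  then show ?thesis unfolding exactly_computable_iff
    by (intro exI[of _ "\<lambda>\<sigma>. f \<sigma> + e * g \<sigma>"] conjI) (simp_all add: fg of_rat_add of_rat_mult)
qed

lemma exactly_computable_rescale:
  assumes "exactly_computable d"
  shows "exactly_computable (\<lambda>\<tau>. d (\<sigma> @ \<tau>) / d \<sigma>)"
proof -
  obtain f where f: "computable no_oracle f" "d = (\<lambda>\<sigma>. of_rat (f \<sigma>))"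
    using assms unfolding exactly_computable_iff by blast
  have "computable no_oracle (\<lambda>\<tau>. f (\<sigma> @ \<tau>) / f \<sigma>)"
    by (intro computable_divide_rat computable_compose[OF f(1)] computable_intros)
  then show ?thesis unfolding exactly_computable_iff
    by (intro exI[of _ "\<lambda>\<tau>. f (\<sigma> @ \<tau>) / f \<sigma>"] conjI) (simp_all add: f of_rat_divide)
qed

lemma martingale_add_scaled:
  assumes "martingale d" "martingale m" "0 \<le> e"
  shows "martingale (\<lambda>\<sigma>. d \<sigma> + e * m \<sigma>)"
  unfolding martingale_def
proof (intro allI conjI)
  fix \<sigma>
  have *: "d \<sigma> = (d (\<sigma> @ [False]) + d (\<sigma> @ [True])) / 2" "m \<sigma> = (m (\<sigma> @ [False]) + m (\<sigma> @ [True])) / 2"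
    "0 \<le> d \<sigma>" "0 \<le> m \<sigma>"
    using assms unfolding martingale_def by blast+
  show "0 \<le> d \<sigma> + e * m \<sigma>" using * assms(3) by simp
  show "d \<sigma> + e * m \<sigma> = (d (\<sigma> @ [False]) + e * m (\<sigma> @ [False]) + (d (\<sigma> @ [True]) + e * m (\<sigma> @ [True]))) / 2"
    by (subst *(1), subst *(2)) (simp add: algebra_simps add_divide_distrib)
qed

section \<open>Open sets without a winning cover\<close>

text \<open>
  Otherwise the normed martingale \<open>\<tau> \<mapsto> d (\<sigma> \<tau>) / d \<sigma>\<close> would reach \<open>q\<close> on all of \<open>S\<close>.
\<close>

lemma uncovered_avoids_winning:
  assumes uncov: "\<not> (\<exists>V. winning_open V \<and> S \<subseteq> V)"
    and d: "exactly_computable d" "martingale d" "0 < d \<sigma>" and q: "1 < (q :: rat)"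
  shows "\<exists>Y\<in>S. \<forall>n. d (\<sigma> @ stake n Y) < of_rat q * d \<sigma>"
proof -
  define m where "m \<tau> = d (\<sigma> @ \<tau>) / d \<sigma>" for \<tau>
  have "martingale m"
    unfolding martingale_def
  proof (intro allI conjI)
    fix \<tau>
    show "0 \<le> m \<tau>" using d(2,3) by (simp add: m_def martingale_def)
    have "d (\<sigma> @ \<tau>) = (d (\<sigma> @ \<tau> @ [False]) + d (\<sigma> @ \<tau> @ [True])) / 2"
      using d(2) unfolding martingale_def by (metis append_assoc)
    then show "m \<tau> = (m (\<tau> @ [False]) + m (\<tau> @ [True])) / 2"
      by (simp add: m_def add_divide_distrib)
  qed
  moreover have "normed m" using d(3) by (simp add: normed_def m_def)
  moreover have "exactly_computable m" unfolding m_def by (rule exactly_computable_rescale[OF d(1)])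
  ultimately have "winning_open (open_of {\<tau>. minimal_string (\<lambda>\<tau>. of_rat q \<le> m \<tau>) \<tau>})"
    using q unfolding winning_open_def by blast
  then obtain Y where Y: "Y \<in> S" "Y \<notin> open_of {\<tau>. minimal_string (\<lambda>\<tau>. of_rat q \<le> m \<tau>) \<tau>}"
    using uncov by blast
  have "m (stake n Y) < of_rat q" for n
  proof (rule ccontr)
    assume "\<not> m (stake n Y) < of_rat q"
    then have ex: "\<exists>k. of_rat q \<le> m (stake k Y)" by (auto simp: not_less)
    define k where "k = (LEAST k. of_rat q \<le> m (stake k Y))"
    have "of_rat q \<le> m (stake k Y)"
      unfolding k_def using LeastI_ex[OF ex] .
    moreover have "\<not> of_rat q \<le> m \<tau>" if "strict_prefix \<tau> (stake k Y)" for \<tau>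
    proof -
      have "length \<tau> < k" using prefix_length_less[OF that] by simp
      moreover have "\<tau> = take (length \<tau>) (stake k Y)"
        using that by (auto simp: strict_prefix_def prefix_def)
      ultimately have "\<tau> = stake (length \<tau>) Y" by (simp add: take_stake min_absorb1)
      with not_less_Least[of "length \<tau>" "\<lambda>k. of_rat q \<le> m (stake k Y)"] \<open>length \<tau> < k\<close>
      show ?thesis by (simp add: k_def)
    qed
    ultimately have "minimal_string (\<lambda>\<tau>. of_rat q \<le> m \<tau>) (stake k Y)"
      by (simp add: minimal_string_def)
    with Y(2) show False by (auto simp: open_of_def)
  qed
  then have "d (\<sigma> @ stake n Y) < of_rat q * d \<sigma>" for n
    using d(3) by (simp add: m_def pos_divide_less_eq)
  with Y(1) show ?thesis by blast
qed

definition powers :: "bool list set \<Rightarrow> nat \<Rightarrow> bool list set" where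
  "powers U m = {concat l | l. set l \<subseteq> U \<and> length l = m}"

text \<open>
  The stages of the construction are pairs of a string and an exactly computable martingale that is
  at least \<open>1\<close> everywhere and below \<open>2\<close> at the string. At stage \<open>n\<close> the \<open>n\<close>-th exactly computable
  martingale is added with a weight so small that the value at the current string stays below \<open>2\<close>;
  the strict inequality leaves room for a factor \<open>q > 1\<close>, and an element of \<open>U\<close> is appended along
  which the sum does not gain this factor. In the end the \<open>n\<close>-th martingale is bounded along the
  resulting sequence by \<open>2\<close> divided by its weight.
\<close>

lemma computably_random_in_powers:
  assumes uncov: "\<not> (\<exists>V. winning_open V \<and> open_of U \<subseteq> V)" and nil: "[] \<notin> U"
  shows "\<exists>X. False ## X \<in> CR \<and> (\<forall>m. X \<in> open_of (powers U m))"
proof -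
  define \<M> where "\<M> = {d. exactly_computable d \<and> martingale d}"
  have "countable \<M>" unfolding \<M>_def
    by (rule countable_subset[OF _ countable_exactly_computable]) auto
  moreover have "(\<lambda>_. 1) \<in> \<M>" by (simp add: \<M>_def exactly_computable_const martingale_def)
  ultimately have range_M: "range (from_nat_into \<M>) = \<M>" by (intro range_from_nat_into) auto
  define M where "M = from_nat_into \<M>"
  have M: "exactly_computable (M n)" "martingale (M n)" for n
    using range_M unfolding M_def \<M>_def by blast+
  have M_nonneg: "0 \<le> M n \<sigma>" for n \<sigma> using M(2) by (simp add: martingale_def)
  \<comment> \<open>The invariant of a stage, and the transition from stage \<open>n\<close> to stage \<open>n + 1\<close>.\<close>
  define P :: "bool list \<times> (bool list \<Rightarrow> real) \<Rightarrow> bool" where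
    "P s \<longleftrightarrow> exactly_computable (snd s) \<and> martingale (snd s) \<and> (\<forall>\<tau>. 1 \<le> snd s \<tau>) \<and> snd s (fst s) < 2" for s
  define Q :: "nat \<Rightarrow> bool list \<times> (bool list \<Rightarrow> real) \<Rightarrow> bool list \<times> (bool list \<Rightarrow> real) \<Rightarrow> bool" where
    "Q n s s' \<longleftrightarrow> (\<exists>\<tau>\<in>U. fst s' = fst s @ \<tau>) \<and> (\<exists>e>0. snd s' = (\<lambda>\<rho>. snd s \<rho> + e * M n \<rho>)) \<and>
      (\<forall>\<rho>. prefix (fst s) \<rho> \<longrightarrow> prefix \<rho> (fst s') \<longrightarrow> snd s' \<rho> < 2)" for n s s'
  have "\<exists>s'. P s' \<and> Q n s s'" if "P s" for n s
  proof -
    obtain \<sigma> d where s: "s = (\<sigma>, d)" by (cases s)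
    have d: "exactly_computable d" "martingale d" "\<And>\<tau>. 1 \<le> d \<tau>" "d \<sigma> < 2"
      using that by (auto simp: P_def s)
    have "0 < (2 - d \<sigma>) / (M n \<sigma> + 1)" using d(4) M_nonneg[of n \<sigma>] by simp
    then obtain e :: rat where e: "0 < real_of_rat e" "real_of_rat e < (2 - d \<sigma>) / (M n \<sigma> + 1)"
      using of_rat_dense by blast
    define d' where "d' \<rho> = d \<rho> + of_rat e * M n \<rho>" for \<rho>
    have "real_of_rat e * (M n \<sigma> + 1) < 2 - d \<sigma>"
      using e(2) M_nonneg[of n \<sigma>] by (simp add: pos_less_divide_eq)
    moreover have "real_of_rat e * (M n \<sigma> + 1) = real_of_rat e * M n \<sigma> + real_of_rat e"
      by (simp add: algebra_simps)
    ultimately have d'_less: "d' \<sigma> < 2" using e(1) unfolding d'_def by linarith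
    have d'_ge: "1 \<le> d' \<rho>" for \<rho>
      using d(3)[of \<rho>] mult_nonneg_nonneg[OF less_imp_le[OF e(1)] M_nonneg[of n \<rho>]] by (simp add: d'_def)
    have d': "exactly_computable d'" "martingale d'"
      unfolding d'_def[abs_def]
      by (rule exactly_computable_add_scaled[OF d(1) M(1)])
        (rule martingale_add_scaled[OF d(2) M(2) less_imp_le[OF e(1)]])
    have pos: "0 < d' \<sigma>" using d'_ge[of \<sigma>] by simp
    have "1 < 2 / d' \<sigma>" using d'_less pos by (simp add: pos_less_divide_eq)
    then obtain q :: rat where q: "1 < real_of_rat q" "real_of_rat q < 2 / d' \<sigma>"
      using of_rat_dense by blast
    then have q1: "1 < q" and q2: "of_rat q * d' \<sigma> < 2" using pos by (simp_all add: pos_less_divide_eq)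
    obtain Y where Y: "Y \<in> open_of U" "\<And>k. d' (\<sigma> @ stake k Y) < of_rat q * d' \<sigma>"
      using uncovered_avoids_winning[OF uncov d' pos q1] by blast
    obtain k where k: "stake k Y \<in> U" using Y(1) by (auto simp: open_of_def)
    define s' where "s' = (\<sigma> @ stake k Y, d')"
    have small: "d' \<rho> < 2" if "prefix \<sigma> \<rho>" "prefix \<rho> (\<sigma> @ stake k Y)" for \<rho>
    proof -
      obtain \<rho>' where \<rho>': "\<rho> = \<sigma> @ \<rho>'" using \<open>prefix \<sigma> \<rho>\<close> by (auto simp: prefix_def)
      with that(2) have pre: "prefix \<rho>' (stake k Y)" by simp
      have "length \<rho>' \<le> k" using prefix_length_le[OF pre] by simp
      moreover have "\<rho>' = take (length \<rho>') (stake k Y)" using pre by (auto simp: prefix_def)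
      ultimately have "\<rho>' = stake (length \<rho>') Y" by (simp add: take_stake min_absorb1)
      with Y(2)[of "length \<rho>'"] q2 show ?thesis by (simp add: \<rho>')
    qed
    have "P s'" using d' d'_ge small by (auto simp: P_def s'_def)
    moreover have "\<exists>e'>0. d' = (\<lambda>\<rho>. d \<rho> + e' * M n \<rho>)"
      unfolding d'_def[abs_def] by (intro exI[of _ "of_rat e"] conjI e(1) refl)
    then have "Q n s s'"
      unfolding Q_def s'_def s using k small by auto
    ultimately show ?thesis by blast
  qed
  moreover have "P ([False], \<lambda>_. 1)"
    by (simp add: P_def exactly_computable_const martingale_def)
  ultimately have "\<exists>S. \<forall>n. (P (S n) \<and> (n = 0 \<longrightarrow> S n = ([False], \<lambda>_. 1))) \<and> Q n (S n) (S (Suc n))"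
    by (intro dependent_nat_choice) auto
  then obtain S where S0: "S 0 = ([False], \<lambda>_. 1)" and SP: "\<And>n. P (S n)"
    and SQ: "\<And>n. Q n (S n) (S (Suc n))"
    by blast
  define \<sigma> where "\<sigma> n = fst (S n)" for n
  define D where "D n = snd (S n)" for n
  have \<sigma>0: "\<sigma> 0 = [False]" by (simp add: \<sigma>_def S0)
  have \<sigma>_Suc: "\<exists>\<tau>\<in>U. \<sigma> (Suc n) = \<sigma> n @ \<tau>" for n using SQ[of n] by (auto simp: Q_def \<sigma>_def)
  have pre: "prefix (\<sigma> m) (\<sigma> n)" if "m \<le> n" for m n
    using that
  proof (induction n rule: dec_induct)
    case (step n)
    obtain \<tau> where "\<sigma> (Suc n) = \<sigma> n @ \<tau>" using \<sigma>_Suc by blast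
    with step.IH show ?case by simp
  qed simp
  have len: "n < length (\<sigma> n)" for n
  proof (induction n)
    case (Suc n)
    obtain \<tau> where "\<tau> \<in> U" "\<sigma> (Suc n) = \<sigma> n @ \<tau>" using \<sigma>_Suc by blast
    then show ?case using Suc nil by (cases \<tau>) auto
  qed (simp add: \<sigma>0)
  define Z where "Z = to_stream (\<lambda>i. \<sigma> i ! i)"
  have stake_Z: "stake (length (\<sigma> n)) Z = \<sigma> n" for n
  proof (rule nth_equalityI)
    fix i assume "i < length (stake (length (\<sigma> n)) Z)"
    then have i: "i < length (\<sigma> n)" by simp
    have "\<sigma> i ! i = \<sigma> n ! i"
      using pre[of i n] pre[of n i] len[of i] i by (cases "i \<le> n") (auto simp: prefix_def nth_append)
    with i show "stake (length (\<sigma> n)) Z ! i = \<sigma> n ! i" by (simp add: Z_def to_stream_def)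
  qed simp
  have \<sigma>_powers: "\<exists>\<tau>\<in>powers U n. \<sigma> n = False # \<tau>" for n
  proof (induction n)
    case 0
    then show ?case by (auto simp: \<sigma>0 powers_def)
  next
    case (Suc n)
    then obtain l where "\<sigma> n = False # concat l" "set l \<subseteq> U" "length l = n" by (auto simp: powers_def)
    moreover obtain \<tau> where "\<tau> \<in> U" "\<sigma> (Suc n) = \<sigma> n @ \<tau>" using \<sigma>_Suc by blast
    ultimately have "\<sigma> (Suc n) = False # concat (l @ [\<tau>])" "set (l @ [\<tau>]) \<subseteq> U" "length (l @ [\<tau>]) = Suc n"
      by auto
    then show ?case unfolding powers_def by blast
  qed
  obtain X where X: "Z = False ## X"
  proof -
    have "shd Z = False" using stake_Z[of 0] by (simp add: \<sigma>0)
    then show thesis using that[of "stl Z"] by (metis stream.collapse)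
  qed
  have X_powers: "X \<in> open_of (powers U m)" for m
  proof -
    obtain \<tau> where "\<tau> \<in> powers U m" "\<sigma> m = False # \<tau>" using \<sigma>_powers by blast
    moreover have "stake (length \<tau>) X = \<tau>" using stake_Z[of m] \<open>\<sigma> m = False # \<tau>\<close> by (simp add: X)
    ultimately show ?thesis unfolding open_of_def by (intro CollectI exI[of _ "length \<tau>"]) simp
  qed
  have "Z \<in> CR"
    unfolding CR_def
  proof (intro CollectI allI impI)
    fix d assume "martingale d \<and> computable_string_real no_oracle d"
    then obtain E where E: "exactly_computable E" "martingale E" "\<And>\<sigma>. d \<sigma> \<le> E \<sigma>"
      using computable_martingale_dominated by blast
    then obtain i where i: "E = M i" using range_M unfolding M_def \<M>_def by blast
    obtain e where e: "0 < e" "\<And>\<rho>. D (Suc i) \<rho> = D i \<rho> + e * M i \<rho>"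
      using SQ[of i] by (auto simp: Q_def D_def)
    have D_ge: "1 \<le> D n \<rho>" for n \<rho> using SP[of n] by (auto simp: P_def D_def)
    have D_mono: "D m \<rho> \<le> D n \<rho>" if "m \<le> n" for m n \<rho>
      using that
    proof (induction n rule: dec_induct)
      case (step n)
      obtain e' where "0 < e'" "D (Suc n) \<rho> = D n \<rho> + e' * M n \<rho>"
        using SQ[of n] by (auto simp: Q_def D_def)
      then have "D n \<rho> \<le> D (Suc n) \<rho>" using M_nonneg[of n \<rho>] by simp
      with step show ?case by simp
    qed simp
    show "\<not> succeeds_on d Z"
    proof (rule not_succeeds_onI)
      fix m assume m: "length (\<sigma> i) \<le> m"
      \<comment> \<open>The stage during which the bit at position \<open>m\<close> was chosen.\<close>
      define n where "n = (GREATEST n. length (\<sigma> n) \<le> m)"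
      have bounded: "\<And>n. length (\<sigma> n) \<le> m \<Longrightarrow> n \<le> m" using len less_le_trans by (meson less_imp_le)
      have n: "length (\<sigma> n) \<le> m" unfolding n_def using m bounded by (rule GreatestI_nat)
      have "i \<le> n" unfolding n_def using m bounded by (rule Greatest_le_nat)
      have "\<not> length (\<sigma> (Suc n)) \<le> m"
      proof
        assume "length (\<sigma> (Suc n)) \<le> m"
        then have "Suc n \<le> n" unfolding n_def using bounded by (rule Greatest_le_nat)
        then show False by simp
      qed
      have pre_stake: "prefix (stake k Z) (stake l Z)" if "k \<le> l" for k l
        using take_is_prefix[of k "stake l Z"] that by (simp add: take_stake min_absorb1)
      have "prefix (\<sigma> n) (stake m Z)" using pre_stake[OF n] by (simp add: stake_Z)
      moreover have "prefix (stake m Z) (\<sigma> (Suc n))"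
        using pre_stake[of m "length (\<sigma> (Suc n))"] \<open>\<not> _ \<le> m\<close> by (simp add: stake_Z)
      ultimately have "D (Suc n) (stake m Z) < 2"
        using SQ[of n] by (auto simp: Q_def \<sigma>_def D_def)
      moreover have "D (Suc i) (stake m Z) \<le> D (Suc n) (stake m Z)"
        using D_mono \<open>i \<le> n\<close> by simp
      ultimately have "e * M i (stake m Z) < 2"
        using e(2)[of "stake m Z"] D_ge[of i "stake m Z"] by linarith
      then have "E (stake m Z) \<le> 2 / e" using e(1) by (simp add: i pos_le_divide_eq mult.commute)
      with E(3)[of "stake m Z"] show "d (stake m Z) \<le> 2 / e" by simp
    qed
  qed
  with X X_powers show ?thesis by blast
qed

section \<open>The Schnorr test of powers\<close>

lemma powers_0: "powers U 0 = {[]}"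
  by (auto simp: powers_def)

lemma powers_Suc: "powers U (Suc m) = {u @ v | u v. u \<in> U \<and> v \<in> powers U m}"
proof
  show "powers U (Suc m) \<subseteq> {u @ v | u v. u \<in> U \<and> v \<in> powers U m}"
    by (auto simp: powers_def length_Suc_conv) blast
  show "{u @ v | u v. u \<in> U \<and> v \<in> powers U m} \<subseteq> powers U (Suc m)"
  proof
    fix \<sigma> assume "\<sigma> \<in> {u @ v | u v. u \<in> U \<and> v \<in> powers U m}"
    then obtain u l where "u \<in> U" "set l \<subseteq> U" "length l = m" "\<sigma> = u @ concat l"
      by (auto simp: powers_def)
    then show "\<sigma> \<in> powers U (Suc m)"
      unfolding powers_def by (intro CollectI exI[of _ "u # l"]) auto
  qed
qed

lemma open_of_Nil: "open_of {[]} = UNIV"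
proof -
  have "stake 0 X \<in> {[]}" for X :: "bool stream" by simp
  then show ?thesis unfolding open_of_def by blast
qed

lemma measure_open_powers:
  assumes "prefix_free U"
  shows "\<mu> (open_of (powers U m)) = \<mu> (open_of U) ^ m"
proof (induction m)
  case 0
  then show ?case using cantor.prob_space by (simp add: powers_0 open_of_Nil)
next
  case (Suc m)
  then show ?case by (simp add: powers_Suc measure_open_of_concat[OF assms])
qed

lemma open_powers_antimono: "m \<le> n \<Longrightarrow> open_of (powers U n) \<subseteq> open_of (powers U m)"
proof
  fix X assume le: "m \<le> n" and "X \<in> open_of (powers U n)"
  then obtain k l where l: "stake k X = concat l" "set l \<subseteq> U" "length l = n"
    by (auto simp: open_of_def powers_def)
  have "concat l = concat (take m l) @ concat (drop m l)"
    by (metis append_take_drop_id concat_append)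
  then have "take (length (concat (take m l))) (stake k X) = concat (take m l)" using l by simp
  moreover have "length (concat (take m l)) \<le> k"
    by (metis \<open>concat l = _\<close> l(1) length_append length_stake le_add1)
  ultimately have "stake (length (concat (take m l))) X = concat (take m l)"
    by (simp add: take_stake min_absorb1)
  moreover have "concat (take m l) \<in> powers U m"
    unfolding powers_def using l le set_take_subset[of m l] by (intro CollectI exI[of _ "take m l"]) auto
  ultimately show "X \<in> open_of (powers U m)"
    unfolding open_of_def by (intro CollectI exI[of _ "length (concat (take m l))"]) simp
qed

lemma Stream_in_open:
  assumes "[] \<notin> W"
  shows "b ## X \<in> open_of W \<longleftrightarrow> X \<in> open_of {\<sigma>. b # \<sigma> \<in> W}"
proof
  assume "b ## X \<in> open_of W"
  then obtain n where n: "stake n (b ## X) \<in> W" by (auto simp: open_of_def)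
  have "n \<noteq> 0"
  proof
    assume "n = 0"
    with n have "[] \<in> W" by simp
    with assms show False ..
  qed
  then obtain m where "n = Suc m" by (cases n) auto
  with n have "stake m X \<in> {\<sigma>. b # \<sigma> \<in> W}" by simp
  then show "X \<in> open_of {\<sigma>. b # \<sigma> \<in> W}" unfolding open_of_def by blast
next
  assume "X \<in> open_of {\<sigma>. b # \<sigma> \<in> W}"
  then obtain n where "stake (Suc n) (b ## X) \<in> W" by (auto simp: open_of_def)
  then show "b ## X \<in> open_of W" unfolding open_of_def by blast
qed

text \<open>
  Let \<open>r = \<mu> [U]\<close> and choose \<open>k\<close> with \<open>r\<^sup>k \<le> 1/2\<close>. The \<open>n\<close>-th member of the test consists of
  \<open>[U\<^bsup>kn\<^esup>]\<close> below the bit \<open>0\<close> and an initial interval of length \<open>z n = 2 2\<^sup>-\<^sup>n - r\<^bsup>kn\<^esup>\<close> below the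
  bit \<open>1\<close>, so its measure is \<open>(r\<^bsup>kn\<^esup> + z n) / 2 = 2\<^sup>-\<^sup>n\<close>. The lengths \<open>z n\<close> decrease because
  \<open>r\<^bsup>kn\<^esup> \<le> 2\<^sup>-\<^sup>n\<close>. The interval is enumerable because \<open>z n\<close> can be approximated from below, which
  amounts to approximating \<open>r\<close> from above.
\<close>

lemma Schnorr_test_of_powers:
  assumes U: "semidec A (\<lambda>\<sigma>. \<sigma> \<in> U)" "prefix_free U"
    and r: "computable_real A (\<mu> (open_of U))" "\<mu> (open_of U) < 1"
  shows "\<exists>T. Schnorr_test A T \<and> (\<forall>X. (\<forall>m. X \<in> open_of (powers U m)) \<longrightarrow> False ## X \<in> (\<Inter>n. T n))"
proof -
  define r where "r = \<mu> (open_of U)"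
  have r0: "0 \<le> r" and r1: "r < 1" using assms(4) by (auto simp: r_def)
  obtain k where "r ^ k < 1 / 2" using real_arch_pow_inv[of "1 / 2" r] r1 by auto
  then have k: "r ^ k \<le> 1 / 2" by simp
  have rk: "r ^ (k * n) \<le> (1 / 2) ^ n" for n
    unfolding power_mult using k r0 by (intro power_mono) auto
  define z where "z n = 2 * (1 / 2) ^ n - r ^ (k * n)" for n
  have z0: "0 \<le> z n" for n using rk[of n] zero_le_power[of "1 / 2 :: real" n] unfolding z_def by linarith
  have z1: "z n \<le> 1" for n
  proof (cases n)
    case (Suc m)
    have "(1 / 2 :: real) ^ m \<le> 1" by (simp add: power_le_one)
    moreover have "0 \<le> r ^ (k * n)" using r0 by simp
    ultimately show ?thesis by (simp add: z_def Suc del: mult_Suc_right)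
  qed (simp add: z_def)
  have z_dec: "z (Suc n) \<le> z n" for n
  proof -
    have "0 \<le> r ^ (k * Suc n)" using r0 by simp
    moreover have "z (Suc n) = (1 / 2) ^ n - r ^ (k * Suc n)" by (simp add: z_def)
    ultimately show ?thesis using rk[of n] unfolding z_def[of n] by linarith
  qed
  define W where "W n = {False # \<sigma> | \<sigma>. \<sigma> \<in> powers U (k * n)} \<union> {True # \<sigma> | \<sigma>. \<sigma> \<in> below (z n)}" for n
  define T where "T n = open_of (W n)" for n
  have F_T: "False ## X \<in> T n \<longleftrightarrow> X \<in> open_of (powers U (k * n))"
    and T_T: "True ## X \<in> T n \<longleftrightarrow> X \<in> open_of (below (z n))" for X n
    unfolding T_def by (subst Stream_in_open; auto simp: W_def)+
  have \<mu>T: "\<mu> (T n) = (1 / 2) ^ n" for n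
  proof -
    have "\<mu> (T n) = (r ^ (k * n) + z n) / 2"
      by (subst measure_halves)
        (simp_all add: T_def[symmetric] F_T T_T measure_open_powers[OF U(2)] measure_open_below z0 z1 r_def,
          simp add: T_def)
    then show ?thesis by (simp add: z_def)
  qed
  have dec: "decseq T"
  proof (rule decseq_SucI, rule subsetI)
    fix n X assume X: "X \<in> T (Suc n)"
    obtain b Y where bY: "X = b ## Y" by (cases X) auto
    have "open_of (powers U (k * Suc n)) \<subseteq> open_of (powers U (k * n))"
      by (rule open_powers_antimono) simp
    moreover have "open_of (below (z (Suc n))) \<subseteq> open_of (below (z n))"
      by (rule open_of_mono) (use z_dec[of n] in \<open>auto simp: below_def\<close>)
    ultimately show "X \<in> T n" using X unfolding bY by (cases b) (auto simp: F_T T_T)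
  qed
  have "semidec A (\<lambda>p. snd p \<in> W (fst p))"
  proof -
    obtain a where a: "computable A a" "\<And>n. \<bar>of_rat (a n) - r\<bar> \<le> (1 / 2) ^ n"
      using r(1) unfolding computable_real_iff r_def by blast
    \<comment> \<open>Rational upper bounds of \<open>r\<close> that converge to \<open>r\<close>.\<close>
    define q where "q t = a t + (1 / 2) ^ t" for t
    have cq: "computable A q" unfolding q_def
      by (intro computable_add_rat computable_compose[OF a(1)] computable_intros)
    have q_eq: "real_of_rat (q t) = of_rat (a t) + (1 / 2) ^ t" for t
      by (simp add: q_def of_rat_add of_rat_power of_rat_divide)
    have q_ge: "r \<le> of_rat (q t)" for t
      unfolding q_eq using a(2)[of t] by linarith
    have q_lim: "(\<lambda>t. real_of_rat (q t)) \<longlonglongrightarrow> r"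
    proof (rule tendsto_sandwich)
      show "\<forall>\<^sub>F t in sequentially. r \<le> real_of_rat (q t)" using q_ge by simp
      show "\<forall>\<^sub>F t in sequentially. real_of_rat (q t) \<le> r + 2 * (1 / 2) ^ t"
      proof (rule always_eventually, rule allI)
        show "real_of_rat (q t) \<le> r + 2 * (1 / 2) ^ t" for t
          unfolding q_eq using a(2)[of t] by linarith
      qed
      have "(\<lambda>t. r + 2 * (1 / 2 :: real) ^ t) \<longlonglongrightarrow> r + 2 * 0"
        by (intro tendsto_intros LIMSEQ_realpow_zero) auto
      then show "(\<lambda>t. r + 2 * (1 / 2 :: real) ^ t) \<longlonglongrightarrow> r" by simp
    qed auto
    have below_iff: "\<sigma> \<in> below (z n) \<longleftrightarrow> (\<exists>t. right \<sigma> + q t ^ (k * n) < 2 * (1 / 2) ^ n)" for \<sigma> n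
    proof -
      have real: "right \<sigma> + q t ^ (k * n) < 2 * (1 / 2) ^ n \<longleftrightarrow>
          of_rat (right \<sigma>) + real_of_rat (q t) ^ (k * n) < 2 * (1 / 2) ^ n" for t
      proof -
        have "right \<sigma> + q t ^ (k * n) < 2 * (1 / 2) ^ n \<longleftrightarrow>
          real_of_rat (right \<sigma> + q t ^ (k * n)) < real_of_rat (2 * (1 / 2) ^ n)"
          by (simp only: of_rat_less)
        then show ?thesis by (simp add: of_rat_add of_rat_power of_rat_mult of_rat_divide)
      qed
      show ?thesis
      proof
        assume "\<sigma> \<in> below (z n)"
        then have "of_rat (right \<sigma>) + r ^ (k * n) < 2 * (1 / 2) ^ n" by (simp add: below_def z_def)
        moreover have "(\<lambda>t. of_rat (right \<sigma>) + real_of_rat (q t) ^ (k * n)) \<longlonglongrightarrow> of_rat (right \<sigma>) + r ^ (k * n)"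
          by (intro tendsto_intros q_lim)
        ultimately have "\<forall>\<^sub>F t in sequentially. of_rat (right \<sigma>) + real_of_rat (q t) ^ (k * n) < 2 * (1 / 2) ^ n"
          by (rule order_tendstoD(2)[rotated])
        then show "\<exists>t. right \<sigma> + q t ^ (k * n) < 2 * (1 / 2) ^ n"
          unfolding real by (auto simp: eventually_sequentially)
      next
        assume "\<exists>t. right \<sigma> + q t ^ (k * n) < 2 * (1 / 2) ^ n"
        then obtain t where "of_rat (right \<sigma>) + real_of_rat (q t) ^ (k * n) < 2 * (1 / 2) ^ n"
          unfolding real by blast
        moreover have "r ^ (k * n) \<le> real_of_rat (q t) ^ (k * n)"
          by (intro power_mono q_ge r0)
        ultimately show "\<sigma> \<in> below (z n)" by (simp add: below_def z_def)
      qed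
    qed
    have "semidec A (\<lambda>p. (\<exists>l. (\<forall>y\<in>set l. y \<in> U) \<and> length l = k * fst p \<and> snd p = False # concat l) \<or>
        (\<exists>x::nat \<times> bool list. snd p = True # snd x \<and> right (snd x) + q (fst x) ^ (k * fst p) < 2 * (1 / 2) ^ fst p))"
      by (intro semidec_disj semidec_ex semidec_conj semidec_ball_list U computable_imp_semidec
        computable_eq_nat computable_eq_string computable_less_rat computable_add_rat computable_mult_rat computable_power_rat
        computable_compose[OF computable_right] computable_compose[OF cq] computable_intros)
    moreover have "snd p \<in> W (fst p) \<longleftrightarrow>
        (\<exists>l. (\<forall>y\<in>set l. y \<in> U) \<and> length l = k * fst p \<and> snd p = False # concat l) \<or>
        (\<exists>x::nat \<times> bool list. snd p = True # snd x \<and> right (snd x) + q (fst x) ^ (k * fst p) < 2 * (1 / 2) ^ fst p)" for p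
      unfolding W_def powers_def subset_eq by (auto simp: below_iff; blast)
    ultimately show ?thesis by simp
  qed
  from prefix_free_generators[OF this] obtain W' :: "nat \<Rightarrow> bool list set" where
    "semidec A (\<lambda>p. snd p \<in> W' (fst p))" "\<And>n. prefix_free (W' n)" "\<And>n. open_of (W' n) = T n"
    unfolding T_def by blast
  then have "uniformly_ce_open A T"
    unfolding uniformly_ce_open_def uniformly_ce_strings_iff_semidec by metis
  then have "Schnorr_test A T" using dec \<mu>T by (simp add: Schnorr_test_def)
  then show ?thesis by (intro exI[of _ T]) (simp add: F_T)
qed

lemma Low_imp_covering:
  assumes low: "A \<in> Low CR SR" and S: "bounded_open S" "Schnorr_open A S"
  shows "\<exists>V. winning_open V \<and> S \<subseteq> V"
proof (rule ccontr)
  assume uncov: "\<not> (\<exists>V. winning_open V \<and> S \<subseteq> V)"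
  obtain U where U: "semidec A (\<lambda>\<sigma>. \<sigma> \<in> U)" "prefix_free U" and S_eq: "S = open_of U"
    using S(2) unfolding Schnorr_open_def ce_open_def ce_strings_iff_semidec by blast
  have r: "computable_real A (\<mu> (open_of U))" "\<mu> (open_of U) < 1"
    using S by (auto simp: Schnorr_open_def bounded_open_def S_eq)
  have "[] \<notin> U"
  proof
    assume "[] \<in> U"
    then have "open_of {[]} \<subseteq> open_of U" by (intro open_of_mono) auto
    then have "open_of U = UNIV" by (simp add: open_of_Nil top_unique)
    with r(2) show False using cantor.prob_space by simp
  qed
  from computably_random_in_powers[OF uncov[unfolded S_eq] this]
  obtain X where X: "False ## X \<in> CR" "\<And>m. X \<in> open_of (powers U m)" by blast
  obtain T where "Schnorr_test A T" "False ## X \<in> (\<Inter>n. T n)"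
    using Schnorr_test_of_powers[OF U r] X(2) by blast
  then have "False ## X \<notin> SR A" unfolding SR_def by blast
  with X(1) low show False by (auto simp: Low_def)
qed

theorem corollary4p1:
  fixes A :: "bool stream"
  shows "A \<in> Low CR SR \<longleftrightarrow>
    (\<forall>S. bounded_open S \<and> Schnorr_open A S \<longrightarrow> (\<exists>V. winning_open V \<and> S \<subseteq> V))"
  using Low_imp_covering covering_imp_Low by blast

end
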